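(* Consider the distributed problem of minimizing $f=\sum_{i\in V}f_i$ over $X=\bigcap_{i\in V}X_i$ and the random projected subgradient algorithm described in the context. Assume: (1) each $X_i^j\subset\mathbb{R}^d$ ($i\in V$, $j\in I_i$) is closed and convex, and $X\neq\emptyset$; each $f_i:\mathbb{R}^d\to\mathbb{R}$ is convex; for each $i\in V$ there is $M_i\in\mathbb{R}$ with $\|g\|\le M_i$ for all $x\in X_i$ and all $g\in\partial f_i(x)$; for each $i\in V$ there is $C_i\in\mathbb{R}$ with $\|g\|\le C_i$ for all $k\ge0$ and all $g\in\partial f_i(v_i(k))$; (2) there is an integer $Q\ge 1$ such that for every $k\ge 0$ the directed graph $(V,\bigcap_{l=0}^{Q-1}E(k+l))$ is strongly connected; (3) the random variables $\Omega_i(k)$ ($i\in V$, $k\ge0$) are independent, and independent of the initial points $x_i(0)$ ($i\in V$); for each $i$ the variables $\Omega_i(k)$, $k\ge 0$, are identically distributed; and $\Pr\{\Omega_i(k)=j\}>0$ for all $i\in V$, $j\in I_i$; (4) there is $c>0$ such that $\mathrm{d}(x,X)^2\le c\,\mathrm{E}[\mathrm{d}(x,X_i^{\Omega_i(k)})^2]$ for all $i\in V$, $x\in\mathbb{R}^d$, $k\ge 0$; (5) for all $k\ge 0$: $w_{ij}(k)\ge 0$ for all $i,j\in V$, $w_{ij}(k)=0$ if $j\notin N_i(k)$, $\sum_{j\in V}w_{ij}(k)=1$ for all $i$, and $\sum_{i\in V}w_{ij}(k)=1$ for all $j$; moreover there is $w\in(0,1)$ with $w_{ij}(k)\ge w$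 for all $i\in V$, $k\ge0$, $j\in N_i(k)$; and $(\alpha_k)_{k\ge0}\subset(0,\infty)$ satisfies $\sum_{k}\alpha_k=\infty$ and $\sum_k\alpha_k^2<\infty$. Let $x^\star\in X^\star$ and let $(x_i(k))_{k\ge0}$ ($i\in V$) be generated by the algorithm. Then there exist constants $\beta^{(j)}>0$ ($j=1,\dots,4$) such that, almost surely, for all $k\ge0$, $$\mathrm{E}\Big[\sum_{i=1}^m\mathrm{d}(x_i(k+1),X)^2\,\Big|\,\mathcal{F}_k\Big]\le\sum_{i=1}^m\mathrm{d}(x_i(k),X)^2-\beta^{(1)}\gamma_k^{(1)}+\beta^{(2)}\gamma_k^{(2)},$$ $$\mathrm{E}\Big[\sum_{i=1}^m\|x_i(k+1)-x^\star\|^2\,\Big|\,\mathcal{F}_k\Big]\le\sum_{i=1}^m\|x_i(k)-x^\star\|^2-\sum_{j=1,4}\beta^{(j)}\gamma_k^{(j)}+\sum_{j=2,3}\beta^{(j)}\gamma_k^{(j)},$$ where $\gamma_k^{(1)}:=\sum_{i=1}^m\mathrm{d}(v_i(k),X)^2$, $\gamma_k^{(2)}:=\alpha_k^2$, $\gamma_k^{(3)}:=\alpha_k\sum_{i=1}^m\|v_i(k)-\bar v(k)\|$, $\gamma_k^{(4)}:=\alpha_k(f(\bar z(k))-f^\star)$; and $\sum_{k=0}^\infty\gamma_k^{(j)}<\infty$ almost surely for $j=1,2,3,4$.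
   Context: Setting. $V=\{1,\dots,m\}$ is a set of users. $I=\{1,\dots,n\}$ is the disjoint union of nonempty sets $I_i$ ($i\in V$). User $i$ has a function $f_i:\mathbb{R}^d\to\mathbb{R}$ and sets $X_i^j\subset\mathbb{R}^d$ ($j\in I_i$); $X_i:=\bigcap_{j\in I_i}X_i^j$, $X:=\bigcap_{i\in V}X_i$, $f:=\sum_{i\in V}f_i$, $f^\star:=\inf_{x\in X}f(x)$, $X^\star:=\{x\in X: f(x)=f^\star\}$, assumed nonempty. Notation. $\mathbb{R}^d$ carries the Euclidean norm. For a nonempty closed convex $C$, $P_C$ is the metric (nearest-point) projection onto $C$ and $\mathrm{d}(x,C)=\inf_{y\in C}\|x-y\|$. $\partial f_i$ is the convex subdifferential. Network. At each time $k\ge0$ there is a directed graph $(V,E(k))$, $E(k)\subset V\times V$, where $(i,j)\in E(k)$ means $i$ receives information from $j$; $N_i(k):=\{j\in V:(i,j)\in E(k)\}$, and $i\in N_i(k)$ always. $w_{ij}(k)$ are weights and $\alpha_k>0$ step sizes (deterministic). $\Omega_i(k)$ is a random variable with values in $I_i$. Algorithm (random projected subgradient algorithm). Initial points $x_i(0)\in\mathbb{R}^d$ ($i\in V$) are arbitrary (possibly random). For $k\ge0$ and $i\in V$, $$v_i(k):=\sum_{j\in N_i(k)}w_{ij}(k)x_j(k),\quad g_i(k)\in\partial f_i(v_i(k)),\quad x_i(k+1):=P_{X_i^{\Omega_i(k)}}\big(v_i(k)-\alpha_kg_i(k)\big).$$ $\mathcal{F}_k$ is the $\sigma$-algebra generated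 by $x_i(0)$ ($i\in V$) and $\Omega_i(l)$ ($i\in V$, $0\le l\le k-1$); the subgradient $g_i(k)$ is chosen to be $\mathcal{F}_k$-measurable (so the iterates up to time $k$ are determined by $\mathcal{F}_k$). Further, $\bar v(k):=\frac1m\sum_{l=1}^mv_l(k)$, $z_i(k):=P_X(v_i(k))$, $\bar z(k):=\frac1m\sum_{i=1}^mz_i(k)$. *)

theory Defs
  imports "HOL-Probability.Probability" "Graph_Theory.Digraph_Component"
begin

definition subdifferential :: "('a::real_inner \<Rightarrow> real) \<Rightarrow> 'a \<Rightarrow> 'a set" where
  "subdifferential h x = {s. \<forall>y. h y \<ge> h x + s \<bullet> (y - x)}"

text \<open>The infimum is taken in the extended reals, since the infimum of a set of reals that is
  unbounded below is an unspecified real number; in that case the set of minimizers is empty.\<close>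

definition opt_value :: "('a \<Rightarrow> real) \<Rightarrow> 'a set \<Rightarrow> ereal" where
  "opt_value h X = (INF x\<in>X. ereal (h x))"

definition solution_set :: "('a \<Rightarrow> real) \<Rightarrow> 'a set \<Rightarrow> 'a set" where
  "solution_set h X = {x \<in> X. ereal (h x) = opt_value h X}"

definition generated_sigma ::
  "'w measure \<Rightarrow> 'i set \<Rightarrow> ('i \<Rightarrow> 'b measure) \<Rightarrow> ('i \<Rightarrow> 'w \<Rightarrow> 'b) \<Rightarrow> 'w set set" where
  "generated_sigma M J N Y =
     sigma_sets (space M) (\<Union>i\<in>J. {Y i -` A \<inter> space M | A. A \<in> sets (N i)})"

text \<open>The \<open>\<sigma>\<close>-algebra generated by \<open>x\<^sub>i(0)\<close> for all users \<open>i\<close> and by \<open>\<Omega>\<^sub>i(l)\<close> for all users \<open>i\<close>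
  and all \<open>l < k\<close>; \<open>Idx i\<close> is the finite range of \<open>\<Omega>\<^sub>i\<close>.\<close>

definition history ::
  "'w measure \<Rightarrow> nat set \<Rightarrow> (nat \<Rightarrow> nat set) \<Rightarrow> (nat \<Rightarrow> nat \<Rightarrow> 'w \<Rightarrow> 'a::topological_space) \<Rightarrow>
   (nat \<Rightarrow> nat \<Rightarrow> 'w \<Rightarrow> nat) \<Rightarrow> nat \<Rightarrow> 'w measure" where
  "history M V Idx x \<Omega> k = sigma (space M)
     (generated_sigma M V (\<lambda>_. borel) (\<lambda>i. x i 0) \<union>
      generated_sigma M (V \<times> {..<k}) (\<lambda>(i, l). count_space (Idx i)) (\<lambda>(i, l). \<Omega> i l))"

text \<open>Conditional expectation of a nonnegative random variable that need not be integrable, as an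
  extended real; the value is \<open>\<infinity>\<close> where the conditional expectation is infinite.  As with \<open>nn_cond_exp\<close>, this is meaningful only if
  \<open>Y\<close> is measurable and \<open>G\<close> is a subalgebra of \<open>M\<close>.\<close>

definition nonneg_cond_exp :: "'w measure \<Rightarrow> 'w measure \<Rightarrow> ('w \<Rightarrow> real) \<Rightarrow> 'w \<Rightarrow> ereal" where
  "nonneg_cond_exp M G Y \<omega> = enn2ereal (nn_cond_exp M G (\<lambda>\<omega>'. ennreal (Y \<omega>')) \<omega>)"

definition neighbours :: "nat set \<Rightarrow> (nat \<Rightarrow> (nat \<times> nat) set) \<Rightarrow> nat \<Rightarrow> nat \<Rightarrow> nat set" where
  "neighbours V E i k = {j \<in> V. (i, j) \<in> E k}"

definition weighted_state ::
  "nat set \<Rightarrow> (nat \<Rightarrow> (nat \<times> nat) set) \<Rightarrow> (nat \<Rightarrow> nat \<Rightarrow> nat \<Rightarrow> real) \<Rightarrow>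
   (nat \<Rightarrow> nat \<Rightarrow> 'w \<Rightarrow> 'a::real_vector) \<Rightarrow> nat \<Rightarrow> nat \<Rightarrow> 'w \<Rightarrow> 'a" where
  "weighted_state V E w x i k \<omega> = (\<Sum>j\<in>neighbours V E i k. w i j k *\<^sub>R x j k \<omega>)"

definition user_mean :: "nat set \<Rightarrow> (nat \<Rightarrow> 'a::real_vector) \<Rightarrow> 'a" where
  "user_mean V u = (1 / real (card V)) *\<^sub>R (\<Sum>i\<in>V. u i)"

text \<open>The terms \<open>\<gamma>\<^sub>k\<^sup>(\<^sup>j\<^sup>)\<close> for \<open>j = 1, 2, 3, 4\<close>, written \<open>gamma_term \<dots> j k \<omega>\<close>; here \<open>h\<close> is the objective
  and \<open>v\<close> the process of the \<open>v\<^sub>i(k)\<close>. The two applications of \<open>user_mean\<close> are the averages of the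
  \<open>v\<^sub>i(k)\<close> and of their projections \<open>z\<^sub>i(k)\<close> onto \<open>X\<close>.\<close>

definition gamma_term ::
  "nat set \<Rightarrow> 'a::euclidean_space set \<Rightarrow> ('a \<Rightarrow> real) \<Rightarrow> (nat \<Rightarrow> real) \<Rightarrow>
   (nat \<Rightarrow> nat \<Rightarrow> 'w \<Rightarrow> 'a) \<Rightarrow> nat \<Rightarrow> nat \<Rightarrow> 'w \<Rightarrow> real" where
  "gamma_term V X h \<alpha> v j k \<omega> =
     (if j = 1 then \<Sum>i\<in>V. (infdist (v i k \<omega>) X)\<^sup>2
      else if j = 2 then (\<alpha> k)\<^sup>2
      else if j = 3 then \<alpha> k * (\<Sum>i\<in>V. norm (v i k \<omega> - user_mean V (\<lambda>l. v l k \<omega>)))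
      else \<alpha> k * (h (user_mean V (\<lambda>i. closest_point X (v i k \<omega>))) - real_of_ereal (opt_value h X)))"

end

theory Submission
  imports Defs
begin

text \<open>One step satisfies
  \<open>\<parallel>P\<^sub>C (v - \<alpha> g) - u\<parallel>\<^sup>2 + d(v, C)\<^sup>2 / 2 \<le> \<parallel>v - u\<parallel>\<^sup>2 - 2 \<alpha> \<langle>g, v - u\<rangle> + 2 \<alpha>\<^sup>2 \<parallel>g\<parallel>\<^sup>2\<close>
  for \<open>u \<in> C\<close>. Since \<open>\<Omega>\<^sub>i(k)\<close> is independent of the history, the conditional expectation of
  \<open>d(v, C)\<^sup>2\<close> is at least \<open>d(v, X)\<^sup>2 / c\<close>; with \<open>u = P\<^sub>X v\<close> and \<open>u = x\<^sup>*\<close> this gives the two inequalities.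

  No supermartingale convergence theorem is needed for the summability: the inequalities are
  multiplied by the weight \<open>1 / (1 + \<Sum>\<^sub>i \<parallel>x\<^sub>i(0) - x\<^sup>*\<parallel>\<^sup>2)\<close>, integrated, and summed over \<open>k\<close>. For the
  disagreement term, every \<open>E(k)\<close> contains a strongly connected graph and is hence strongly connected
  itself, so a single averaging step contracts the disagreement in \<open>\<ell>\<^sup>2\<close>, and the perturbations
  \<open>x\<^sub>i(k+1) - v\<^sub>i(k)\<close> are bounded by \<open>d(v\<^sub>i(k), X)\<close> and \<open>\<alpha>\<^sub>k\<close>.\<close>

subsection \<open>Subgradients and projections\<close>

text \<open>The two inequalities differ in kind. The first closes on its own: its only positive term
  comes from the summable squares of \<open>\<alpha> k\<close>, so it controls the infeasibility.
  The second carries the disagreement with a plus sign and says nothing about the gap until the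
  disagreement is controlled. Infeasibility feeds the disagreement, through a bound valid along each
  path, and the disagreement feeds the gap.

  The constants follow from a budget. The random projection earns half a squared distance, whose
  conditional mean is at least d(v, X)^2 / (2c); Young's inequality spends d(v, X)^2 / (4c) on the
  subgradient term; the remaining 1 / (4c) is the first constant.

  Subgradients are bounded on \<open>X\<close> and, almost surely, at the points v_i(k). The
  selected subgradient at v_i(k) is tested against \<open>xstar\<close>, while function values are
  compared by subgradients at feasible points: the projections z_i(k) and their mean.

  The initial points need not be integrable, so the expected energies may be infinite. The weight
  repairs this at time 0, and the telescoping takes place in \<open>ennreal\<close>, where terms are
  added and never subtracted.\<close>

lemma subdifferential_nonempty:
  fixes f :: "'a::euclidean_space \<Rightarrow> real"
  assumes "convex_on UNIV f"
  shows "subdifferential f x \<noteq> {}"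
proof -
  \<comment> \<open>A subgradient is a non-vertical supporting hyperplane of the epigraph. The
    strict epigraph is disjoint from the point (x, f x), so it can be separated from it; a limit in
    the height recovers the graph itself.\<close>
  let ?T = "{(y, t). f y < t}"
  have "convex ?T"
  proof (rule convexI)
    fix p q :: "'a \<times> real" and u v :: real
    assume pq: "p \<in> ?T" "q \<in> ?T" and uv: "0 \<le> u" "0 \<le> v" "u + v = 1"
    obtain y t y' t' where p: "p = (y, t)" and q: "q = (y', t')" by (cases p, cases q)
    have h: "f y < t" "f y' < t'" "0 \<le> u" "0 \<le> v" "u + v = 1" using pq uv p q by auto
    have "f (u *\<^sub>R y + v *\<^sub>R y') \<le> u * f y + v * f y'"
      using assms h by (simp add: convex_on_def)
    also have "\<dots> < u * t + v * t'"
    proof (cases "u = 0")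
      case False
      then have "u * f y < u * t" using h by simp
      moreover have "v * f y' \<le> v * t'" using h by (intro mult_left_mono) auto
      ultimately show ?thesis by simp
    qed (use h in auto)
    finally show "u *\<^sub>R p + v *\<^sub>R q \<in> ?T" by (simp add: p q)
  qed
  moreover have "(x, f x + 1) \<in> ?T" by simp
  then have "?T \<noteq> {}" by blast
  moreover have "{(x, f x)} \<inter> ?T = {}" by auto
  ultimately obtain p c where p: "p \<noteq> 0" "p \<bullet> (x, f x) \<le> c" "\<And>q. q \<in> ?T \<Longrightarrow> c \<le> p \<bullet> q"
    using separating_hyperplane_sets[of "{(x, f x)}" ?T] by auto
  obtain a b where ab: "p = (a, b)" by (cases p)
  have sep: "a \<bullet> x + b * f x \<le> a \<bullet> y + b * t" if "f y < t" for y t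
    using p(2) p(3)[of "(y, t)"] that by (simp add: ab)
  have "0 \<le> b" using sep[of x "f x + 1"] by (simp add: algebra_simps)
  moreover have "b \<noteq> 0"
  proof
    assume b: "b = 0"
    \<comment> \<open>A vertical normal would make the functional given by \<open>a\<close> minimal
      at \<open>x\<close> over the whole space; the test point \<open>x - a\<close> then forces
      \<open>a = 0\<close>.\<close>
    have "a \<bullet> x \<le> a \<bullet> (x - a)" using sep[of "x - a" "f (x - a) + 1"] b by simp
    then have "a \<bullet> a \<le> 0" by (simp add: inner_diff_right)
    then have "a = 0" by (metis inner_eq_zero_iff inner_ge_zero order_antisym)
    with b p(1) ab show False by (simp add: zero_prod_def)
  qed
  ultimately have b: "b > 0" by simp
  have "f x + (- (1 / b)) *\<^sub>R a \<bullet> (y - x) \<le> f y" for y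
  proof -
    have "a \<bullet> x + b * f x \<le> a \<bullet> y + b * f y"
    proof (rule field_le_epsilon)
      fix e :: real assume "0 < e"
      then show "a \<bullet> x + b * f x \<le> a \<bullet> y + b * f y + e"
        using sep[of y "f y + e / b"] b by (simp add: algebra_simps)
    qed
    then have "b * (f x + (- (1 / b)) *\<^sub>R a \<bullet> (y - x)) \<le> b * f y"
      using b by (simp add: algebra_simps inner_diff_right)
    then show ?thesis using b by (simp only: mult_le_cancel_left_pos)
  qed
  then show ?thesis unfolding subdifferential_def by blast
qed

text \<open>A single subgradient at \<open>x\<close> gives the estimate, so the bound is taken at
  \<open>x\<close> while \<open>y\<close> is arbitrary: a feasible \<open>x\<close> can be compared
  with an infeasible \<open>y\<close>.\<close>

lemma subgradient_bound_lower:
  fixes f :: "'a::euclidean_space \<Rightarrow> real"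
  assumes "convex_on UNIV f" and "\<And>s. s \<in> subdifferential f x \<Longrightarrow> norm s \<le> B"
  shows "f x - B * norm (y - x) \<le> f y"
proof -
  obtain s where s: "s \<in> subdifferential f x" using subdifferential_nonempty[OF assms(1)] by blast
  have "\<bar>s \<bullet> (y - x)\<bar> \<le> B * norm (y - x)"
    using Cauchy_Schwarz_ineq2[of s "y - x"] mult_right_mono[OF assms(2)[OF s], of "norm (y - x)"] by simp
  moreover have "f x + s \<bullet> (y - x) \<le> f y" using s by (simp add: subdifferential_def)
  ultimately show ?thesis by simp
qed

text \<open>The obtuse angle at the projection p gives |p - u|^2 + |v - a - p|^2 \<le> |v - a -
  u|^2. The second square, often discarded, is kept: after adding |a|^2 it dominates half the
  squared distance from \<open>v\<close> to \<open>C\<close>.\<close>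

lemma closest_point_step:
  fixes v a u :: "'a::euclidean_space"
  assumes C: "closed C" "convex C" and u: "u \<in> C"
  shows "(norm (closest_point C (v - a) - u))\<^sup>2 + (infdist v C)\<^sup>2 / 2
    \<le> (norm (v - u))\<^sup>2 - 2 * (a \<bullet> (v - u)) + 2 * (norm a)\<^sup>2"
proof -
  define p where "p = closest_point C (v - a)"
  have pC: "p \<in> C" unfolding p_def using C u closest_point_exists(1) by blast
  have "(v - a - p) \<bullet> (u - p) \<le> 0" unfolding p_def using closest_point_dot[OF C(2,1) u] .
  then have 1: "(norm (p - u))\<^sup>2 + (norm (v - a - p))\<^sup>2 \<le> (norm (v - a - u))\<^sup>2"
    unfolding power2_norm_eq_inner by (simp add: algebra_simps inner_commute)
  have "infdist v C \<le> norm (v - p)" using infdist_le[OF pC, of v] by (simp add: dist_norm)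
  also have "\<dots> \<le> norm (v - a - p) + norm a"
    using norm_triangle_ineq[of "v - a - p" a] by simp
  finally have "(infdist v C)\<^sup>2 \<le> (norm (v - a - p) + norm a)\<^sup>2"
    by (intro power_mono infdist_nonneg)
  also have "\<dots> \<le> 2 * (norm (v - a - p))\<^sup>2 + 2 * (norm a)\<^sup>2"
    using sum_squares_bound[of "norm (v - a - p)" "norm a"] by (simp add: power2_sum)
  finally have 2: "(infdist v C)\<^sup>2 / 2 \<le> (norm (v - a - p))\<^sup>2 + (norm a)\<^sup>2" by simp
  have "(norm (v - a - u))\<^sup>2 = (norm (v - u))\<^sup>2 - 2 * (a \<bullet> (v - u)) + (norm a)\<^sup>2"
    unfolding power2_norm_eq_inner by (simp add: algebra_simps inner_commute)
  with 1 2 show ?thesis unfolding p_def by simp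
qed

lemma infdist_eq_dist_closest_point:
  fixes C :: "'a::euclidean_space set"
  assumes "closed C" "C \<noteq> {}"
  shows "infdist x C = dist x (closest_point C x)"
  using setdist_closest_point[OF assms] by (simp add: infdist_eq_setdist)

text \<open>The convex combination of the two projections lies in \<open>C\<close>, which makes the
  distance convex; squaring preserves this because the distance is nonnegative.\<close>

lemma convex_on_infdist_power2:
  fixes C :: "'a::euclidean_space set"
  assumes C: "closed C" "convex C" "C \<noteq> {}"
  shows "convex_on UNIV (\<lambda>x. (infdist x C)\<^sup>2)"
proof (rule convex_onI)
  fix t :: real and x y :: 'a
  assume t: "0 < t" "t < 1"
  let ?p = "closest_point C x" and ?q = "closest_point C y"
  have "(1 - t) *\<^sub>R ?p + t *\<^sub>R ?q \<in> C"
    using C t closest_point_exists(1)[OF C(1,3)] by (intro convexD) auto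
  then have "infdist ((1 - t) *\<^sub>R x + t *\<^sub>R y) C
      \<le> dist ((1 - t) *\<^sub>R x + t *\<^sub>R y) ((1 - t) *\<^sub>R ?p + t *\<^sub>R ?q)"
    by (rule infdist_le)
  also have "\<dots> = norm ((1 - t) *\<^sub>R (x - ?p) + t *\<^sub>R (y - ?q))"
    by (simp add: dist_norm algebra_simps)
  also have "\<dots> \<le> (1 - t) * infdist x C + t * infdist y C"
    using t by (intro norm_triangle_le) (simp add: infdist_eq_dist_closest_point[OF C(1,3)] dist_norm)
  finally have "(infdist ((1 - t) *\<^sub>R x + t *\<^sub>R y) C)\<^sup>2 \<le> ((1 - t) * infdist x C + t * infdist y C)\<^sup>2"
    by (intro power_mono infdist_nonneg)
  also have "\<dots> \<le> (1 - t) * (infdist x C)\<^sup>2 + t * (infdist y C)\<^sup>2"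
    using convex_onD[OF convex_power2, of t "infdist x C" "infdist y C"] t by simp
  finally show "(infdist ((1 - t) *\<^sub>R x + t *\<^sub>R y) C)\<^sup>2
      \<le> (1 - t) * (infdist x C)\<^sup>2 + t * (infdist y C)\<^sup>2" .
qed simp

lemma convex_on_norm_diff_power2:
  "convex_on UNIV (\<lambda>x::'a::euclidean_space. (norm (x - a))\<^sup>2)"
  using convex_on_infdist_power2[of "{a}"] by (simp add: dist_norm)

subsection \<open>Averaging with doubly stochastic weights\<close>

text \<open>Young's inequality with a free parameter: a small \<open>r\<close> keeps the coefficient
  of the first square so close to 1 that a contraction by \<open>1 - r\<close> still wins.\<close>

lemma norm_add_power2_le:
  fixes a b :: "'a::real_normed_vector" and r :: real
  assumes "0 < r"
  shows "(norm (a + b))\<^sup>2 \<le> (1 + r) * (norm a)\<^sup>2 + (1 + 1 / r) * (norm b)\<^sup>2"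
proof -
  have "(norm (a + b))\<^sup>2 \<le> (norm a + norm b)\<^sup>2" by (intro power_mono norm_triangle_ineq) auto
  moreover have "0 \<le> (r * norm a - norm b)\<^sup>2 / r" using assms by simp
  then have "2 * norm a * norm b \<le> r * (norm a)\<^sup>2 + (norm b)\<^sup>2 / r"
    using assms by (simp add: field_simps power2_eq_square)
  ultimately show ?thesis by (simp add: power2_sum algebra_simps)
qed

text \<open>The row sums enter through Jensen's inequality, the column sums after the order of
  summation is exchanged.\<close>

lemma sum_convex_doubly_stochastic_le:
  assumes V: "finite V" "V \<noteq> {}"
    and nonneg: "\<And>i j. i \<in> V \<Longrightarrow> j \<in> V \<Longrightarrow> 0 \<le> W i j"
    and row: "\<And>i. i \<in> V \<Longrightarrow> (\<Sum>j\<in>V. W i j) = 1"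
    and col: "\<And>j. j \<in> V \<Longrightarrow> (\<Sum>i\<in>V. W i j) = 1"
    and \<phi>: "convex_on UNIV \<phi>"
  shows "(\<Sum>i\<in>V. \<phi> (\<Sum>j\<in>V. W i j *\<^sub>R y j)) \<le> (\<Sum>j\<in>V. \<phi> (y j))"
proof -
  have "(\<Sum>i\<in>V. \<phi> (\<Sum>j\<in>V. W i j *\<^sub>R y j)) \<le> (\<Sum>i\<in>V. \<Sum>j\<in>V. W i j * \<phi> (y j))"
    using V \<phi> nonneg row by (intro sum_mono convex_on_sum) auto
  also have "\<dots> = (\<Sum>j\<in>V. (\<Sum>i\<in>V. W i j) * \<phi> (y j))"
    by (subst sum.swap) (simp add: sum_distrib_right)
  also have "\<dots> = (\<Sum>j\<in>V. \<phi> (y j))" using col by simp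
  finally show ?thesis .
qed

lemma norm_diff_user_mean_le:
  fixes y :: "nat \<Rightarrow> 'a::real_normed_vector"
  assumes V: "finite V" "V \<noteq> {}" and D: "\<And>j. j \<in> V \<Longrightarrow> norm (a - y j) \<le> D j"
  shows "norm (a - user_mean V y) \<le> (\<Sum>j\<in>V. D j) / card V"
proof -
  have c: "real (card V) > 0" using V by (simp add: card_gt_0_iff)
  have "a - user_mean V y = (1 / card V) *\<^sub>R (\<Sum>j\<in>V. a - y j)"
    using c V by (simp add: user_mean_def sum_subtractf scaleR_diff_right sum_constant_scaleR)
  then have "norm (a - user_mean V y) = (1 / card V) * norm (\<Sum>j\<in>V. a - y j)" by simp
  also have "\<dots> \<le> (1 / card V) * (\<Sum>j\<in>V. D j)"
    using D c by (intro mult_left_mono sum_norm_le) auto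
  finally show ?thesis by simp
qed

lemma sum_diff_user_mean:
  fixes y :: "nat \<Rightarrow> 'a::real_normed_vector"
  assumes V: "finite V" "V \<noteq> {}"
  shows "(\<Sum>i\<in>V. y i - user_mean V y) = 0"
proof -
  have c: "real (card V) \<noteq> 0" using V by simp
  have "(\<Sum>i\<in>V. y i - user_mean V y) = (\<Sum>i\<in>V. y i) - real (card V) *\<^sub>R user_mean V y"
    using V by (simp add: sum_subtractf sum_constant_scaleR)
  then show ?thesis using c by (simp add: user_mean_def)
qed

text \<open>Pythagoras about the mean: the cross term vanishes because the deviations sum to
  zero.\<close>

lemma sum_norm_diff_user_mean_le:
  fixes y :: "nat \<Rightarrow> 'a::real_inner"
  assumes V: "finite V" "V \<noteq> {}"
  shows "(\<Sum>i\<in>V. (norm (y i - user_mean V y))\<^sup>2) \<le> (\<Sum>i\<in>V. (norm (y i - a))\<^sup>2)"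
proof -
  let ?b = "user_mean V y"
  have "(norm (y i - a))\<^sup>2 = (norm (y i - ?b))\<^sup>2 + 2 * ((y i - ?b) \<bullet> (?b - a)) + (norm (?b - a))\<^sup>2" for i
    unfolding power2_norm_eq_inner by (simp add: algebra_simps inner_commute)
  then have "(\<Sum>i\<in>V. (norm (y i - a))\<^sup>2) = (\<Sum>i\<in>V. (norm (y i - ?b))\<^sup>2)
      + 2 * ((\<Sum>i\<in>V. y i - ?b) \<bullet> (?b - a)) + real (card V) * (norm (?b - a))\<^sup>2"
    by (simp add: sum.distrib sum_distrib_left inner_sum_left del: sum_subtractf)
  then show ?thesis using V by (simp add: sum_diff_user_mean)
qed

text \<open>The loss in Jensen's inequality for the squared norm is exactly a variance. A lower
  bound for this variance is what turns averaging into a strict contraction.\<close>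

lemma weighted_variance_eq:
  fixes u :: "'i \<Rightarrow> 'a::real_inner"
  assumes "(\<Sum>j\<in>V. p j) = (1::real)"
  defines "s \<equiv> (\<Sum>j\<in>V. p j *\<^sub>R u j)"
  shows "(\<Sum>j\<in>V. p j * (norm (u j))\<^sup>2) - (norm s)\<^sup>2 = (\<Sum>j\<in>V. p j * (norm (u j - s))\<^sup>2)"
proof -
  have "p j * (norm (u j - s))\<^sup>2 = p j * (norm (u j))\<^sup>2 - 2 * ((p j *\<^sub>R u j) \<bullet> s) + p j * (norm s)\<^sup>2" for j
    unfolding power2_norm_eq_inner by (simp add: algebra_simps inner_commute)
  then have "(\<Sum>j\<in>V. p j * (norm (u j - s))\<^sup>2) = (\<Sum>j\<in>V. p j * (norm (u j))\<^sup>2)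
      - 2 * ((\<Sum>j\<in>V. p j *\<^sub>R u j) \<bullet> s) + (\<Sum>j\<in>V. p j) * (norm s)\<^sup>2"
    by (simp add: sum.distrib sum_subtractf sum_distrib_left sum_distrib_right inner_sum_left)
  then show ?thesis using assms by (simp add: power2_norm_eq_inner)
qed

lemma norm_diff_relpow_le:
  fixes y :: "'i \<Rightarrow> 'a::real_normed_vector"
  assumes "\<And>i j. (i, j) \<in> R \<Longrightarrow> norm (y i - y j) \<le> \<delta>" and "(a, b) \<in> R ^^ n"
  shows "norm (y a - y b) \<le> n * \<delta>"
  using assms(2)
proof (induction n arbitrary: b)
  case (Suc n)
  then obtain c where c: "(a, c) \<in> R ^^ n" "(c, b) \<in> R" by auto
  have "norm (y a - y b) \<le> norm (y a - y c) + norm (y c - y b)"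
    using norm_triangle_ineq[of "y a - y c" "y c - y b"] by simp
  also have "\<dots> \<le> n * \<delta> + \<delta>" using Suc.IH[OF c(1)] assms(1)[OF c(2)] by simp
  finally show ?case by (simp add: algebra_simps)
qed simp

text \<open>The loss of energy in one averaging step controls \<open>norm (y i - y j)\<close> along every edge, hence,
  along paths, the distance between any two of the \<open>y i\<close>.\<close>

lemma doubly_stochastic_contraction:
  fixes y :: "nat \<Rightarrow> 'a::euclidean_space"
  assumes V: "finite V" "V \<noteq> {}"
    and nonneg: "\<And>i j. i \<in> V \<Longrightarrow> j \<in> V \<Longrightarrow> 0 \<le> W i j"
    and row: "\<And>i. i \<in> V \<Longrightarrow> (\<Sum>j\<in>V. W i j) = 1"
    and col: "\<And>j. j \<in> V \<Longrightarrow> (\<Sum>i\<in>V. W i j) = 1"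
    and R: "R \<subseteq> V \<times> V" "\<And>i. i \<in> V \<Longrightarrow> (i, i) \<in> R" "V \<times> V \<subseteq> R\<^sup>*"
    and wmin: "0 < wmin" "\<And>i j. (i, j) \<in> R \<Longrightarrow> wmin \<le> W i j"
  defines "z \<equiv> \<lambda>i. \<Sum>j\<in>V. W i j *\<^sub>R y j"
  shows "(\<Sum>i\<in>V. (norm (z i - user_mean V z))\<^sup>2)
    \<le> (1 - wmin / (2 * real (card V) ^ 5)) * (\<Sum>i\<in>V. (norm (y i - user_mean V y))\<^sup>2)"
proof -
  define m where "m = real (card V)"
  have m: "m \<ge> 1" unfolding m_def using V by (simp add: Suc_leI card_gt_0_iff)
  define b where "b = user_mean V y"
  define u where "u j = y j - b" for j
  define s where "s i = (\<Sum>j\<in>V. W i j *\<^sub>R u j)" for i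
  \<comment> \<open>Unit column sums preserve the mean, so both sides of the contraction are
    measured from the same centre \<open>b\<close>.\<close>
  have "(\<Sum>i\<in>V. z i) = (\<Sum>j\<in>V. (\<Sum>i\<in>V. W i j) *\<^sub>R y j)"
    unfolding z_def by (subst sum.swap) (simp add: scaleR_sum_left)
  then have "user_mean V z = b" using col by (simp add: user_mean_def b_def)
  moreover have "z i - b = s i" if "i \<in> V" for i
  proof -
    have "s i = z i - (\<Sum>j\<in>V. W i j) *\<^sub>R b"
      by (simp add: s_def z_def u_def scaleR_diff_right sum_subtractf scaleR_sum_left)
    then show ?thesis using row[OF that] by simp
  qed
  ultimately have lhs: "(\<Sum>i\<in>V. (norm (z i - user_mean V z))\<^sup>2) = (\<Sum>i\<in>V. (norm (s i))\<^sup>2)" by simp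
  define var where "var i = (\<Sum>j\<in>V. W i j * (norm (u j - s i))\<^sup>2)" for i
  have var0: "0 \<le> var i" if "i \<in> V" for i
    unfolding var_def using nonneg[OF that] by (intro sum_nonneg) simp
  define \<Delta> where "\<Delta> = (\<Sum>i\<in>V. (norm (u i))\<^sup>2) - (\<Sum>i\<in>V. (norm (s i))\<^sup>2)"
  have "(\<Sum>i\<in>V. \<Sum>j\<in>V. W i j * (norm (u j))\<^sup>2) = (\<Sum>j\<in>V. (\<Sum>i\<in>V. W i j) * (norm (u j))\<^sup>2)"
    by (subst sum.swap) (simp add: sum_distrib_right)
  then have "\<Delta> = (\<Sum>i\<in>V. (\<Sum>j\<in>V. W i j * (norm (u j))\<^sup>2) - (norm (s i))\<^sup>2)"
    using col by (simp add: \<Delta>_def sum_subtractf)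
  also have "\<dots> = (\<Sum>i\<in>V. var i)"
    unfolding s_def var_def using row by (intro sum.cong weighted_variance_eq) auto
  finally have \<Delta>: "\<Delta> = (\<Sum>i\<in>V. var i)" .
  have \<Delta>0: "0 \<le> \<Delta>" unfolding \<Delta> using var0 by (rule sum_nonneg)
  define \<delta> where "\<delta> = sqrt (2 * \<Delta> / wmin)"
  have \<delta>0: "0 \<le> \<delta>" by (simp add: \<delta>_def \<Delta>0 wmin(1) less_imp_le)
  have edge: "norm (y i - y j) \<le> \<delta>" if ij: "(i, j) \<in> R" for i j
  proof (cases "i = j")
    case False
    have iV: "i \<in> V" "j \<in> V" using ij R(1) by auto
    \<comment> \<open>Both endpoints enter the average \<open>s i\<close> with weight at least
      \<open>wmin\<close>, the endpoint \<open>i\<close> by its self-loop. The comparison therefore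
      goes through \<open>s i\<close>; for \<open>i \<noteq> j\<close> the two terms are distinct
      summands of \<open>var i\<close>.\<close>
    have "(norm (u i - u j))\<^sup>2 \<le> (norm (u i - s i) + norm (u j - s i))\<^sup>2"
      using norm_triangle_ineq4[of "u i - s i" "u j - s i"] by (intro power_mono) auto
    also have "\<dots> \<le> 2 * (norm (u i - s i))\<^sup>2 + 2 * (norm (u j - s i))\<^sup>2"
      using sum_squares_bound[of "norm (u i - s i)" "norm (u j - s i)"] by (simp add: power2_sum)
    finally have "wmin * (norm (u i - u j))\<^sup>2
        \<le> 2 * (wmin * (norm (u i - s i))\<^sup>2 + wmin * (norm (u j - s i))\<^sup>2)"
      using mult_left_mono[of _ _ wmin] wmin(1) by (fastforce simp: algebra_simps)
    also have "\<dots> \<le> 2 * (W i i * (norm (u i - s i))\<^sup>2 + W i j * (norm (u j - s i))\<^sup>2)"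
      using wmin(2)[OF ij] wmin(2)[OF R(2)[OF iV(1)]] by (intro mult_left_mono add_mono mult_right_mono) auto
    also have "W i i * (norm (u i - s i))\<^sup>2 + W i j * (norm (u j - s i))\<^sup>2
        = (\<Sum>l\<in>{i, j}. W i l * (norm (u l - s i))\<^sup>2)" using False by simp
    also have "\<dots> \<le> var i"
      unfolding var_def using iV V nonneg by (intro sum_mono2) auto
    also have "var i \<le> \<Delta>"
      unfolding \<Delta> using iV(1) V var0 by (intro member_le_sum) auto
    finally have "(norm (y i - y j))\<^sup>2 \<le> 2 * \<Delta> / wmin"
      using wmin(1) by (simp add: u_def field_simps)
    then show ?thesis unfolding \<delta>_def by (rule real_le_rsqrt)
  qed (simp add: \<delta>0)
  have fin: "finite R" using R(1) V(1) finite_subset by blast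
  \<comment> \<open>A path needs at most as many edges as \<open>R\<close> has, hence at most m^2.
    This crude count produces m^4 after squaring and m^5 after summation over the users, the
    denominator of the contraction rate.\<close>
  have "card R \<le> card (V \<times> V)" using R(1) V(1) by (intro card_mono) auto
  then have cardR: "real (card R) \<le> m\<^sup>2"
    by (metis card_cartesian_product m_def of_nat_le_iff of_nat_mult power2_eq_square)
  have all: "norm (y i - y j) \<le> m\<^sup>2 * \<delta>" if "i \<in> V" "j \<in> V" for i j
  proof -
    have "(i, j) \<in> R\<^sup>*" using R(3) that by blast
    then obtain n where n: "n \<le> card R" "(i, j) \<in> R ^^ n"
      using rtrancl_finite_eq_relpow[OF fin] by auto
    have "norm (y i - y j) \<le> n * \<delta>" using norm_diff_relpow_le[OF edge n(2)] .
    also have "\<dots> \<le> m\<^sup>2 * \<delta>" using n(1) cardR \<delta>0 by (intro mult_right_mono) auto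
    finally show ?thesis .
  qed
  have "(norm (u i))\<^sup>2 \<le> m ^ 4 * (2 * \<Delta> / wmin)" if "i \<in> V" for i
  proof -
    have "norm (u i) \<le> m\<^sup>2 * \<delta>"
      using norm_diff_user_mean_le[OF V, of "y i" y "\<lambda>_. m\<^sup>2 * \<delta>"] all[OF that] m
      by (simp add: u_def b_def m_def)
    then have "(norm (u i))\<^sup>2 \<le> (m\<^sup>2 * \<delta>)\<^sup>2" by (intro power_mono) auto
    also have "\<dots> = m ^ 4 * (2 * \<Delta> / wmin)"
      using \<Delta>0 wmin(1) by (simp add: \<delta>_def power_mult_distrib flip: power_mult)
    finally show ?thesis .
  qed
  then have "(\<Sum>i\<in>V. (norm (u i))\<^sup>2) \<le> m * (m ^ 4 * (2 * \<Delta> / wmin))"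
    using sum_mono[of V "\<lambda>i. (norm (u i))\<^sup>2" "\<lambda>_. m ^ 4 * (2 * \<Delta> / wmin)"] by (simp add: m_def)
  then have "(\<Sum>i\<in>V. (norm (u i))\<^sup>2) \<le> (2 * m ^ 5 / wmin) * \<Delta>"
    by (simp add: eval_nat_numeral algebra_simps)
  then have "wmin / (2 * m ^ 5) * (\<Sum>i\<in>V. (norm (u i))\<^sup>2) \<le> \<Delta>"
    using wmin(1) m by (simp add: field_simps)
  then show ?thesis
    unfolding lhs unfolding \<Delta>_def u_def b_def m_def by (simp add: algebra_simps)
qed

text \<open>After summation the same sum of \<open>D\<close> appears on both sides and is absorbed
  because \<open>q < 1\<close>; the nonnegative last term \<open>D n\<close> pays for the index
  shift. Summability of the perturbation thus passes to \<open>D\<close>.\<close>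

lemma perturbed_contraction_sum_le:
  fixes D e :: "nat \<Rightarrow> real"
  assumes q: "0 \<le> q" "q < 1" and D0: "\<And>k. 0 \<le> D k"
    and step: "\<And>k. D (Suc k) \<le> q * D k + e k" and e: "\<And>k. 0 \<le> e k"
  shows "(\<Sum>k<n. D k) \<le> (D 0 + (\<Sum>k<n. e k)) / (1 - q)"
proof -
  have "(\<Sum>k<n. D k) \<le> D 0 + (\<Sum>k<n. D (Suc k))"
    using D0[of n] sum.lessThan_Suc_shift[of D n] by simp
  also have "(\<Sum>k<n. D (Suc k)) \<le> q * (\<Sum>k<n. D k) + (\<Sum>k<n. e k)"
    using sum_mono[where K = "{..<n}", OF step] by (simp add: sum.distrib sum_distrib_left)
  finally have "(\<Sum>k<n. D k) * (1 - q) \<le> D 0 + (\<Sum>k<n. e k)" by (simp add: algebra_simps)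
  then show ?thesis using q by (simp add: pos_le_divide_eq)
qed

text \<open>Reachability only grows with the arc set. It is applied with \<open>A\<close> the
  intersection of the graphs over a time window and \<open>R\<close> the first graph of that
  window.\<close>

lemma strongly_connected_superset:
  assumes "strongly_connected (with_proj \<lparr>pverts = V, parcs = A\<rparr>)" "A \<subseteq> R"
  shows "V \<times> V \<subseteq> R\<^sup>*"
proof clarify
  fix a b assume "a \<in> V" "b \<in> V"
  then have "a \<rightarrow>\<^sup>*\<^bsub>with_proj \<lparr>pverts = V, parcs = A\<rparr>\<^esub> b"
    using assms(1) by (auto simp: strongly_connected_def)
  then have "(a, b) \<in> (arcs_ends (with_proj \<lparr>pverts = V, parcs = A\<rparr>))\<^sup>*" by (rule reachable_rtranclI)
  moreover have "arcs_ends (with_proj \<lparr>pverts = V, parcs = A\<rparr>) = A" by (auto simp: arcs_ends_def arc_to_ends_def)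
  ultimately show "(a, b) \<in> R\<^sup>*" using rtrancl_mono[OF assms(2)] by auto
qed

subsection \<open>Independence and conditional expectation\<close>

lemma sigma_algebra_generated_sigma: "sigma_algebra (space M) (generated_sigma M J N Y)"
  unfolding generated_sigma_def by (intro sigma_algebra_sigma_sets) auto

lemma generated_sigma_mono: "J \<subseteq> J' \<Longrightarrow> generated_sigma M J N Y \<subseteq> generated_sigma M J' N Y"
  unfolding generated_sigma_def by (intro sigma_sets_subseteq) auto

lemma generated_sigma_subset_sets:
  assumes "\<And>i. i \<in> J \<Longrightarrow> Y i \<in> measurable M (N i)"
  shows "generated_sigma M J N Y \<subseteq> sets M"
  unfolding generated_sigma_def using assms by (intro sets.sigma_sets_subset) (auto intro: measurable_sets)

lemma generated_sigma_subset_Pow: "generated_sigma M J N Y \<subseteq> Pow (space M)"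
  unfolding generated_sigma_def by (auto dest: sigma_sets_into_sp[rotated])

text \<open>\<open>\<A>\<close> stands for the initial points, \<open>\<B>\<close> for all index
  variables, \<open>\<B>1\<close> for the past ones and \<open>\<C>\<close> for the current one. The
  intersections of a set of \<open>\<A>\<close> with a set of \<open>\<B>1\<close> form a generating
  pi-system on which independence can be checked directly.\<close>

lemma (in prob_space) indep_set_generated_by_Un:
  assumes AB: "indep_set \<A> \<B>" and B1C: "indep_set \<B>1 \<C>"
    and A: "sigma_algebra (space M) \<A>" and B: "sigma_algebra (space M) \<B>"
    and B1: "sigma_algebra (space M) \<B>1"
    and sub: "\<B>1 \<subseteq> \<B>" "\<C> \<subseteq> \<B>" and C: "Int_stable \<C>"
  shows "indep_set (sigma_sets (space M) (\<A> \<union> \<B>1)) \<C>"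
proof -
  interpret A: sigma_algebra "space M" \<A> by fact
  interpret B: sigma_algebra "space M" \<B> by fact
  interpret B1: sigma_algebra "space M" \<B>1 by fact
  define G where "G = {a \<inter> b | a b. a \<in> \<A> \<and> b \<in> \<B>1}"
  have ev: "\<A> \<subseteq> events" "\<B> \<subseteq> events"
    using indep_setD_ev1[OF AB] indep_setD_ev2[OF AB] by auto
  have "indep_set G \<C>"
    unfolding indep_sets2_eq
  proof (intro conjI ballI)
    show "G \<subseteq> events" "\<C> \<subseteq> events" using ev sub by (auto simp: G_def)
    fix g c assume g: "g \<in> G" and c: "c \<in> \<C>"
    then obtain a b where ab: "g = a \<inter> b" "a \<in> \<A>" "b \<in> \<B>1" by (auto simp: G_def)
    have bB: "b \<in> \<B>" and "b \<inter> c \<in> \<B>" using ab c sub by auto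
    \<comment> \<open>\<open>b \<inter> c\<close> is still an event of \<open>\<B>\<close>, so
      \<open>a\<close> splits off first; only then are \<open>b\<close> and \<open>c\<close>
      separated.\<close>
    have "prob (a \<inter> (b \<inter> c)) = prob a * prob (b \<inter> c)"
      using indep_setD[OF AB ab(2) \<open>b \<inter> c \<in> \<B>\<close>] .
    also have "prob (b \<inter> c) = prob b * prob c" using indep_setD[OF B1C ab(3) c] .
    also have "prob a * (prob b * prob c) = prob (a \<inter> b) * prob c"
      using indep_setD[OF AB ab(2) bB] by simp
    finally show "prob (g \<inter> c) = prob g * prob c" by (simp add: ab(1) Int_assoc)
  qed
  moreover have "Int_stable G"
    unfolding Int_stable_def
  proof (intro ballI)
    fix g g' assume "g \<in> G" "g' \<in> G"
    then obtain a b a' b' where "g = a \<inter> b" "a \<in> \<A>" "b \<in> \<B>1" "g' = a' \<inter> b'" "a' \<in> \<A>" "b' \<in> \<B>1"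
      by (auto simp: G_def)
    then have "g \<inter> g' = (a \<inter> a') \<inter> (b \<inter> b')" "a \<inter> a' \<in> \<A>" "b \<inter> b' \<in> \<B>1" by auto
    then show "g \<inter> g' \<in> G" unfolding G_def by blast
  qed
  ultimately have "indep_set (sigma_sets (space M) G) (sigma_sets (space M) \<C>)"
    using C by (rule indep_set_sigma_sets)
  moreover have "sigma_sets (space M) (\<A> \<union> \<B>1) \<subseteq> sigma_sets (space M) G"
  proof (rule sigma_sets_mono, safe)
    fix a assume "a \<in> \<A>"
    then have "a = a \<inter> space M" "a \<inter> space M \<in> G"
      using A.sets_into_space B1.top by (auto simp: G_def)
    then show "a \<in> sigma_sets (space M) G" by (metis sigma_sets.Basic)
  next
    fix b assume "b \<in> \<B>1"
    then have "b = space M \<inter> b" "space M \<inter> b \<in> G"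
      using B1.sets_into_space A.top by (auto simp: G_def)
    then show "b \<in> sigma_sets (space M) G" by (metis sigma_sets.Basic)
  qed
  ultimately show ?thesis
    unfolding indep_sets2_eq using sigma_sets.Basic by blast
qed

lemma (in prob_space) expectation_finite_index:
  fixes \<phi> :: "nat \<Rightarrow> real"
  assumes J: "finite J" and Z: "Z \<in> measurable M (count_space J)"
  shows "expectation (\<lambda>\<omega>. \<phi> (Z \<omega>)) = (\<Sum>j\<in>J. \<phi> j * prob {\<omega>\<in>space M. Z \<omega> = j})"
proof -
  define P where "P j = {\<omega>\<in>space M. Z \<omega> = j}" for j
  have P[measurable]: "P j \<in> events" if "j \<in> J" for j
  proof -
    have "P j = Z -` {j} \<inter> space M" by (auto simp: P_def)
    then show ?thesis using measurable_sets[OF Z, of "{j}"] that by simp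
  qed
  have "expectation (\<lambda>\<omega>. \<phi> (Z \<omega>)) = expectation (\<lambda>\<omega>. \<Sum>j\<in>J. \<phi> j * indicator (P j) \<omega>)"
  proof (intro Bochner_Integration.integral_cong refl)
    fix \<omega> assume \<omega>: "\<omega> \<in> space M"
    have "(\<Sum>j\<in>J. \<phi> j * indicator (P j) \<omega>) = (\<Sum>j\<in>J. if Z \<omega> = j then \<phi> j else 0)"
      using \<omega> by (intro sum.cong) (auto simp: P_def)
    then show "\<phi> (Z \<omega>) = (\<Sum>j\<in>J. \<phi> j * indicator (P j) \<omega>)"
      using measurable_space[OF Z \<omega>] J by simp
  qed
  also have "\<dots> = (\<Sum>j\<in>J. expectation (\<lambda>\<omega>. \<phi> j * indicator (P j) \<omega>))"
    using P by (intro Bochner_Integration.integral_sum) (auto intro!: integrable_mult_right integrable_real_indicator simp: emeasure_eq_measure)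
  also have "\<dots> = (\<Sum>j\<in>J. \<phi> j * prob (P j))"
    using P by (intro sum.cong refl) simp
  finally show ?thesis by (simp add: P_def)
qed

lemma (in prob_space) prob_space_subalgebra:
  "subalgebra M F \<Longrightarrow> finite_measure_subalgebra M F"
  by unfold_locales

lemma (in sigma_finite_subalgebra) nn_cond_exp_finite_sum:
  assumes "finite I" and "\<And>i. i \<in> I \<Longrightarrow> u i \<in> borel_measurable M"
  shows "AE \<omega> in M. nn_cond_exp M F (\<lambda>\<omega>. \<Sum>i\<in>I. u i \<omega>) \<omega> = (\<Sum>i\<in>I. nn_cond_exp M F (u i) \<omega>)"
  using assms
proof (induction I rule: finite_induct)
  case empty
  show ?case using nn_cond_exp_F_meas[of "\<lambda>_. 0"] by auto
next
  case (insert i I)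
  have [measurable]: "u i \<in> borel_measurable M" "(\<lambda>\<omega>. \<Sum>i\<in>I. u i \<omega>) \<in> borel_measurable M"
    using insert.prems by auto
  have "AE \<omega> in M. nn_cond_exp M F (\<lambda>\<omega>. \<Sum>i\<in>I. u i \<omega>) \<omega> = (\<Sum>i\<in>I. nn_cond_exp M F (u i) \<omega>)"
    using insert by auto
  moreover have "AE \<omega> in M. nn_cond_exp M F (u i) \<omega> + nn_cond_exp M F (\<lambda>\<omega>. \<Sum>i\<in>I. u i \<omega>) \<omega>
      = nn_cond_exp M F (\<lambda>\<omega>. u i \<omega> + (\<Sum>i\<in>I. u i \<omega>)) \<omega>"
    by (rule nn_cond_exp_sum) auto
  ultimately show ?case using insert.hyps by (auto elim!: eventually_elim2)
qed

text \<open>The freezing rule: given the history, the quantities \<open>\<phi> j\<close> are known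
  and only the independent index is averaged. Finitely many index values reduce this to the
  indicators of the events \<open>Z = j\<close>.\<close>

lemma (in prob_space) nn_cond_exp_independent_index:
  fixes \<phi> :: "nat \<Rightarrow> 'a \<Rightarrow> ennreal"
  assumes F: "subalgebra M F" and J: "finite J"
    and Z: "Z \<in> measurable M (count_space J)"
    and indep: "\<And>A j. A \<in> sets F \<Longrightarrow> j \<in> J
      \<Longrightarrow> prob (A \<inter> {\<omega>\<in>space M. Z \<omega> = j}) = prob A * prob {\<omega>\<in>space M. Z \<omega> = j}"
    and \<phi>[measurable]: "\<And>j. j \<in> J \<Longrightarrow> \<phi> j \<in> borel_measurable F"
  shows "AE \<omega> in M. (\<Sum>j\<in>J. \<phi> j \<omega> * ennreal (prob {\<omega>\<in>space M. Z \<omega> = j}))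
    = nn_cond_exp M F (\<lambda>\<omega>. \<phi> (Z \<omega>) \<omega>) \<omega>"
proof -
  interpret finite_measure_subalgebra M F using prob_space_subalgebra[OF F] .
  define P where "P j = {\<omega>\<in>space M. Z \<omega> = j}" for j
  have P[measurable]: "P j \<in> events" if "j \<in> J" for j
  proof -
    have "P j = Z -` {j} \<inter> space M" by (auto simp: P_def)
    then show ?thesis using measurable_sets[OF Z, of "{j}"] that by simp
  qed
  have FM: "A \<in> events" if "A \<in> sets F" for A using F that by (auto simp: subalgebra_def)
  \<comment> \<open>By independence the conditional probability of each index value is the constant
    \<open>prob (P j)\<close>.\<close>
  have const: "AE \<omega> in M. ennreal (prob (P j)) = nn_cond_exp M F (indicator (P j)) \<omega>" if j: "j \<in> J" for j
  proof (rule nn_cond_exp_charact)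
    fix A assume A: "A \<in> sets F"
    have "(\<integral>\<^sup>+\<omega>\<in>A. indicator (P j) \<omega> \<partial>M) = (\<integral>\<^sup>+\<omega>. indicator (A \<inter> P j) \<omega> \<partial>M)"
      by (intro nn_integral_cong) (simp split: split_indicator)
    also have "\<dots> = ennreal (prob (A \<inter> P j))"
      using FM[OF A] P[OF j] by (simp add: emeasure_eq_measure)
    also have "\<dots> = ennreal (prob (P j)) * emeasure M A"
      using indep[OF A j] by (simp add: P_def emeasure_eq_measure ennreal_mult mult.commute)
    also have "\<dots> = (\<integral>\<^sup>+\<omega>\<in>A. ennreal (prob (P j)) \<partial>M)"
      using FM[OF A] by (simp add: nn_integral_cmult_indicator)
    finally show "(\<integral>\<^sup>+\<omega>\<in>A. indicator (P j) \<omega> \<partial>M) = (\<integral>\<^sup>+\<omega>\<in>A. ennreal (prob (P j)) \<partial>M)" .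
  qed (use j in auto)
  \<comment> \<open>An \<open>F\<close>-measurable factor passes through the conditional
    expectation, so under the integral the indicator may be replaced by its probability.\<close>
  have swap: "(\<integral>\<^sup>+\<omega>. u \<omega> * indicator (P j) \<omega> \<partial>M) = (\<integral>\<^sup>+\<omega>. u \<omega> * ennreal (prob (P j)) \<partial>M)"
    if j: "j \<in> J" and u: "u \<in> borel_measurable F" for u j
  proof -
    have "(\<integral>\<^sup>+\<omega>. u \<omega> * indicator (P j) \<omega> \<partial>M) = (\<integral>\<^sup>+\<omega>. u \<omega> * nn_cond_exp M F (indicator (P j)) \<omega> \<partial>M)"
      using u P[OF j] by (intro nn_cond_exp_intg[symmetric]) auto
    also have "\<dots> = (\<integral>\<^sup>+\<omega>. u \<omega> * ennreal (prob (P j)) \<partial>M)"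
      using const[OF j] by (intro nn_integral_cong_AE) (auto elim!: eventually_mono)
    finally show ?thesis .
  qed
  have \<phi>M: "\<phi> j \<in> borel_measurable M" if "j \<in> J" for j
    using measurable_from_subalg[OF F \<phi>[OF that]] .
  have ZJ: "Z \<omega> \<in> J" if "\<omega> \<in> space M" for \<omega> using measurable_space[OF Z that] by simp
  have decomp: "\<phi> (Z \<omega>) \<omega> = (\<Sum>j\<in>J. \<phi> j \<omega> * indicator (P j) \<omega>)" if "\<omega> \<in> space M" for \<omega>
  proof -
    have "(\<Sum>j\<in>J. \<phi> j \<omega> * indicator (P j) \<omega>) = (\<Sum>j\<in>J. if Z \<omega> = j then \<phi> j \<omega> else 0)"
      using that by (intro sum.cong) (auto simp: P_def)
    then show ?thesis using ZJ[OF that] J by simp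
  qed
  have "AE \<omega> in M. (\<Sum>j\<in>J. \<phi> j \<omega> * ennreal (prob (P j))) = nn_cond_exp M F (\<lambda>\<omega>. \<phi> (Z \<omega>) \<omega>) \<omega>"
  proof (rule nn_cond_exp_charact)
    fix A assume A: "A \<in> sets F"
    have "(\<integral>\<^sup>+\<omega>\<in>A. \<phi> (Z \<omega>) \<omega> \<partial>M) = (\<integral>\<^sup>+\<omega>. (\<Sum>j\<in>J. (\<phi> j \<omega> * indicator A \<omega>) * indicator (P j) \<omega>) \<partial>M)"
      by (intro nn_integral_cong) (simp add: decomp sum_distrib_left ac_simps)
    also have "\<dots> = (\<Sum>j\<in>J. \<integral>\<^sup>+\<omega>. (\<phi> j \<omega> * indicator A \<omega>) * indicator (P j) \<omega> \<partial>M)"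
      using FM[OF A] \<phi>M P by (intro nn_integral_sum) auto
    also have "\<dots> = (\<Sum>j\<in>J. \<integral>\<^sup>+\<omega>. (\<phi> j \<omega> * indicator A \<omega>) * ennreal (prob (P j)) \<partial>M)"
      using A by (intro sum.cong swap) auto
    also have "\<dots> = (\<integral>\<^sup>+\<omega>. (\<Sum>j\<in>J. (\<phi> j \<omega> * indicator A \<omega>) * ennreal (prob (P j))) \<partial>M)"
      using FM[OF A] \<phi>M by (intro nn_integral_sum[symmetric]) auto
    also have "\<dots> = (\<integral>\<^sup>+\<omega>\<in>A. (\<Sum>j\<in>J. \<phi> j \<omega> * ennreal (prob (P j))) \<partial>M)"
      by (intro nn_integral_cong) (simp add: sum_distrib_left ac_simps)
    finally show "(\<integral>\<^sup>+\<omega>\<in>A. \<phi> (Z \<omega>) \<omega> \<partial>M) = (\<integral>\<^sup>+\<omega>\<in>A. (\<Sum>j\<in>J. \<phi> j \<omega> * ennreal (prob (P j))) \<partial>M)" .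
  next
    have "(\<lambda>\<omega>. \<Sum>j\<in>J. \<phi> j \<omega> * indicator (P j) \<omega>) \<in> borel_measurable M" using \<phi>M P by auto
    then show "(\<lambda>\<omega>. \<phi> (Z \<omega>) \<omega>) \<in> borel_measurable M"
      by (subst measurable_cong[OF decomp])
    show "(\<lambda>\<omega>. \<Sum>j\<in>J. \<phi> j \<omega> * ennreal (prob (P j))) \<in> borel_measurable F" using \<phi> by auto
  qed
  then show ?thesis by (simp add: P_def)
qed

text \<open>Conditioning Y + r \<le> A keeps every term nonnegative, and the history already
  determines \<open>A\<close>. Nonnegativity of \<open>A\<close> need not be arranged separately:
  the inequality supplies it almost surely.\<close>

lemma (in sigma_finite_subalgebra) nonneg_cond_exp_le:
  assumes [measurable]: "Y \<in> borel_measurable M" "r \<in> borel_measurable M" "A \<in> borel_measurable F"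
    and nonneg: "\<And>\<omega>. 0 \<le> Y \<omega>" "\<And>\<omega>. 0 \<le> r \<omega>" "\<And>\<omega>. 0 \<le> G \<omega>"
    and le: "AE \<omega> in M. Y \<omega> + r \<omega> \<le> A \<omega>"
    and G: "AE \<omega> in M. ennreal (G \<omega>) \<le> nn_cond_exp M F (\<lambda>\<omega>. ennreal (r \<omega>)) \<omega>"
  shows "AE \<omega> in M. nonneg_cond_exp M F Y \<omega> \<le> ereal (A \<omega> - G \<omega>)"
proof -
  have [measurable]: "A \<in> borel_measurable M" using measurable_from_subalg[OF subalg assms(3)] .
  have "AE \<omega> in M. nn_cond_exp M F (\<lambda>\<omega>. ennreal (Y \<omega>) + ennreal (r \<omega>)) \<omega>
      \<le> nn_cond_exp M F (\<lambda>\<omega>. ennreal (A \<omega>)) \<omega>"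
    using le nonneg by (intro nn_cond_exp_mono) (auto elim!: eventually_mono intro: ennreal_leI simp flip: ennreal_plus)
  moreover have "AE \<omega> in M. nn_cond_exp M F (\<lambda>\<omega>. ennreal (Y \<omega>)) \<omega> + nn_cond_exp M F (\<lambda>\<omega>. ennreal (r \<omega>)) \<omega>
      = nn_cond_exp M F (\<lambda>\<omega>. ennreal (Y \<omega>) + ennreal (r \<omega>)) \<omega>"
    by (rule nn_cond_exp_sum) auto
  moreover have "AE \<omega> in M. ennreal (A \<omega>) = nn_cond_exp M F (\<lambda>\<omega>. ennreal (A \<omega>)) \<omega>"
    by (rule nn_cond_exp_F_meas) auto
  ultimately show ?thesis
    using G le
  proof eventually_elim
    case (elim \<omega>)
    let ?N = "nn_cond_exp M F (\<lambda>\<omega>. ennreal (Y \<omega>)) \<omega>"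
    have A0: "0 \<le> A \<omega>" using elim(5) nonneg(1,2)[of \<omega>] by linarith
    have "?N + ennreal (G \<omega>) \<le> ?N + nn_cond_exp M F (\<lambda>\<omega>. ennreal (r \<omega>)) \<omega>"
      using elim(4) by (rule add_left_mono)
    also have "\<dots> \<le> ennreal (A \<omega>)" using elim(1-3) by simp
    finally have le: "?N + ennreal (G \<omega>) \<le> ennreal (A \<omega>)" .
    \<comment> \<open>A real upper bound excludes the value infinity, so the subtraction of
      \<open>G\<close> can be carried out in the reals.\<close>
    then have "?N \<noteq> \<top>" by (auto simp: top_unique)
    then obtain n where n: "?N = ennreal n" "0 \<le> n" by (cases ?N) auto
    have "n + G \<omega> \<le> A \<omega>"
      using le n nonneg(3) A0 by (simp flip: ennreal_plus)
    then show ?case by (simp add: nonneg_cond_exp_def n)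
  qed
qed

text \<open>Subtraction truncates in \<open>ennreal\<close>, so the decrease \<open>a\<close> is
  moved to the left before the inequality is integrated.\<close>

lemma enn2ereal_le_imp_add_le:
  assumes "enn2ereal x \<le> ereal (u - a + b)" "0 \<le> u" "0 \<le> a" "0 \<le> b"
  shows "x + ennreal a \<le> ennreal u + ennreal b"
proof -
  have "x \<noteq> \<top>" using assms(1) by auto
  then obtain n where n: "x = ennreal n" "0 \<le> n" by (cases x) auto
  with assms(1) have "n \<le> u - a + b" by simp
  then show ?thesis using assms n by (simp flip: ennreal_plus)
qed

text \<open>The weight is known at every time, so integrating the conditional inequality against it
  gives a recursion for numbers, which telescopes. Infinite values are harmless, since nothing is
  cancelled.\<close>

lemma (in prob_space) weighted_supermartingale_sum_le:
  fixes U a b :: "nat \<Rightarrow> 'a \<Rightarrow> real"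
  assumes F: "\<And>k. subalgebra M (F k)"
    and h: "\<And>k. h \<in> borel_measurable (F k)"
    and meas: "\<And>k. U k \<in> borel_measurable M" "\<And>k. a k \<in> borel_measurable M" "\<And>k. b k \<in> borel_measurable M"
    and nonneg: "\<And>k \<omega>. 0 \<le> U k \<omega>" "\<And>k \<omega>. \<omega> \<in> space M \<Longrightarrow> 0 \<le> a k \<omega>" "\<And>k \<omega>. 0 \<le> b k \<omega>"
    and step: "\<And>k. AE \<omega> in M. nonneg_cond_exp M (F k) (U (Suc k)) \<omega> \<le> ereal (U k \<omega> - a k \<omega> + b k \<omega>)"
  shows "(\<Sum>k. \<integral>\<^sup>+\<omega>. ennreal (h \<omega>) * ennreal (a k \<omega>) \<partial>M)
    \<le> (\<integral>\<^sup>+\<omega>. ennreal (h \<omega>) * ennreal (U 0 \<omega>) \<partial>M) + (\<Sum>k. \<integral>\<^sup>+\<omega>. ennreal (h \<omega>) * ennreal (b k \<omega>) \<partial>M)"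
proof -
  define I where "I u = (\<integral>\<^sup>+\<omega>. ennreal (h \<omega>) * ennreal (u \<omega>) \<partial>M)" for u :: "'a \<Rightarrow> real"
  note [measurable] = meas
  have hM[measurable]: "h \<in> borel_measurable M" using measurable_from_subalg[OF F h] .
  have one: "I (U (Suc k)) + I (a k) \<le> I (U k) + I (b k)" for k
  proof -
    interpret finite_measure_subalgebra M "F k" using prob_space_subalgebra[OF F] .
    let ?N = "nn_cond_exp M (F k) (\<lambda>\<omega>. ennreal (U (Suc k) \<omega>))"
    \<comment> \<open>The defining property of conditional expectation, tested against
      \<open>h\<close>, which is measurable for \<open>F k\<close>.\<close>
    have "I (U (Suc k)) = (\<integral>\<^sup>+\<omega>. ennreal (h \<omega>) * ?N \<omega> \<partial>M)"
      unfolding I_def using h[of k] by (intro nn_cond_exp_intg[symmetric]) auto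
    then have "I (U (Suc k)) + I (a k) = (\<integral>\<^sup>+\<omega>. ennreal (h \<omega>) * ?N \<omega> + ennreal (h \<omega>) * ennreal (a k \<omega>) \<partial>M)"
      unfolding I_def by (simp add: nn_integral_add)
    also have "\<dots> \<le> (\<integral>\<^sup>+\<omega>. ennreal (h \<omega>) * ennreal (U k \<omega>) + ennreal (h \<omega>) * ennreal (b k \<omega>) \<partial>M)"
    proof (rule nn_integral_mono_AE, rule AE_mp[OF step[of k]], rule AE_I2, rule impI)
      fix \<omega> assume \<omega>: "\<omega> \<in> space M"
        and "nonneg_cond_exp M (F k) (U (Suc k)) \<omega> \<le> ereal (U k \<omega> - a k \<omega> + b k \<omega>)"
      then have "?N \<omega> + ennreal (a k \<omega>) \<le> ennreal (U k \<omega>) + ennreal (b k \<omega>)"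
        using nonneg by (intro enn2ereal_le_imp_add_le) (auto simp: nonneg_cond_exp_def)
      then show "ennreal (h \<omega>) * ?N \<omega> + ennreal (h \<omega>) * ennreal (a k \<omega>)
          \<le> ennreal (h \<omega>) * ennreal (U k \<omega>) + ennreal (h \<omega>) * ennreal (b k \<omega>)"
        by (simp flip: distrib_left add: mult_left_mono)
    qed
    also have "\<dots> = I (U k) + I (b k)" unfolding I_def by (simp add: nn_integral_add)
    finally show ?thesis .
  qed
  have part: "I (U n) + (\<Sum>k<n. I (a k)) \<le> I (U 0) + (\<Sum>k<n. I (b k))" for n
  proof (induction n)
    case (Suc n)
    have "I (U (Suc n)) + (\<Sum>k<Suc n. I (a k)) = (I (U (Suc n)) + I (a n)) + (\<Sum>k<n. I (a k))"
      by (simp add: ac_simps)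
    also have "\<dots> \<le> (I (U n) + (\<Sum>k<n. I (a k))) + I (b n)"
      using add_right_mono[OF one[of n], of "\<Sum>k<n. I (a k)"] by (simp add: ac_simps)
    also have "\<dots> \<le> I (U 0) + (\<Sum>k<Suc n. I (b k))"
      using add_right_mono[OF Suc.IH, of "I (b n)"] by (simp add: ac_simps)
    finally show ?case .
  qed simp
  have "(\<Sum>k<n. I (a k)) \<le> I (U 0) + (\<Sum>k. I (b k))" for n
  proof -
    \<comment> \<open>The energy remaining at time \<open>n\<close> is nonnegative and is
      dropped.\<close>
    have "(\<Sum>k<n. I (a k)) \<le> I (U n) + (\<Sum>k<n. I (a k))" by simp
    also note part
    also have "(\<Sum>k<n. I (b k)) \<le> (\<Sum>k. I (b k))" by (intro sum_le_suminf) auto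
    finally show ?thesis by (simp add: add_left_mono)
  qed
  then show ?thesis unfolding I_def[symmetric] suminf_eq_SUP by (intro SUP_least)
qed

text \<open>Monotone convergence moves the series under the integral; a finite integral gives a
  finite series almost everywhere, and the strictly positive factor \<open>h \<omega>\<close> does
  not depend on \<open>k\<close> and divides out.\<close>

lemma AE_summable_of_weighted_sum:
  fixes a :: "nat \<Rightarrow> 'a \<Rightarrow> real"
  assumes [measurable]: "h \<in> borel_measurable M" "\<And>k. a k \<in> borel_measurable M"
    and h: "\<And>\<omega>. 0 < h \<omega>" and a: "\<And>k \<omega>. \<omega> \<in> space M \<Longrightarrow> 0 \<le> a k \<omega>"
    and fin: "(\<Sum>k. \<integral>\<^sup>+\<omega>. ennreal (h \<omega>) * ennreal (a k \<omega>) \<partial>M) < \<infinity>"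
  shows "AE \<omega> in M. summable (\<lambda>k. a k \<omega>)"
proof -
  have "(\<integral>\<^sup>+\<omega>. (\<Sum>k. ennreal (h \<omega>) * ennreal (a k \<omega>)) \<partial>M) \<noteq> \<infinity>"
    using fin by (subst nn_integral_suminf) auto
  then have "AE \<omega> in M. (\<Sum>k. ennreal (h \<omega>) * ennreal (a k \<omega>)) \<noteq> \<infinity>"
    by (intro nn_integral_PInf_AE) auto
  then show ?thesis
  proof (rule AE_mp, intro AE_I2 impI)
    fix \<omega> assume \<omega>: "\<omega> \<in> space M" and ne: "(\<Sum>k. ennreal (h \<omega>) * ennreal (a k \<omega>)) \<noteq> \<infinity>"
    have "(\<Sum>k. ennreal (h \<omega> * a k \<omega>)) \<noteq> \<top>"
      using ne a[OF \<omega>] h[of \<omega>] by (simp add: ennreal_mult less_imp_le)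
    then have "summable (\<lambda>k. h \<omega> * a k \<omega>)"
      using a[OF \<omega>] h[of \<omega>] by (intro summable_suminf_not_top) (auto intro: mult_nonneg_nonneg less_imp_le)
    then show "summable (\<lambda>k. a k \<omega>)" using h[of \<omega>] by (simp add: summable_cmult_iff)
  qed
qed

subsection \<open>The algorithm\<close>

text \<open>The hypotheses in the form in which they are applied: one constant \<open>B\<close> for
  the subgradients on \<open>X\<close> and, almost surely, for the selected ones; reachability in
  each single graph; optimality of \<open>xstar\<close> as a comparison of real sums. Fixing
  \<open>B\<close>, \<open>c\<close> and \<open>wmin\<close> here lets the later constants be
  explicit.\<close>

locale random_projected_subgradient = prob_space M for M :: "'w measure" +
  fixes V :: "nat set"
    and Idx :: "nat \<Rightarrow> nat set"
    and f :: "nat \<Rightarrow> 'a::euclidean_space \<Rightarrow> real"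
    and Xs :: "nat \<Rightarrow> nat \<Rightarrow> 'a set"
    and X :: "'a set"
    and E :: "nat \<Rightarrow> (nat \<times> nat) set"
    and w :: "nat \<Rightarrow> nat \<Rightarrow> nat \<Rightarrow> real"
    and \<alpha> :: "nat \<Rightarrow> real"
    and \<Omega> :: "nat \<Rightarrow> nat \<Rightarrow> 'w \<Rightarrow> nat"
    and x g :: "nat \<Rightarrow> nat \<Rightarrow> 'w \<Rightarrow> 'a"
    and xstar :: 'a
    and B c wmin :: real
  assumes V: "finite V" "V \<noteq> {}"
    and Idx: "\<And>i. i \<in> V \<Longrightarrow> finite (Idx i)"
    and Xs: "\<And>i j. i \<in> V \<Longrightarrow> j \<in> Idx i \<Longrightarrow> closed (Xs i j)"
      "\<And>i j. i \<in> V \<Longrightarrow> j \<in> Idx i \<Longrightarrow> convex (Xs i j)"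
    and X: "closed X" "convex X" "\<And>i j. i \<in> V \<Longrightarrow> j \<in> Idx i \<Longrightarrow> X \<subseteq> Xs i j"
    and f_convex: "\<And>i. i \<in> V \<Longrightarrow> convex_on UNIV (f i)"
    and B: "0 \<le> B" "\<And>i y s. i \<in> V \<Longrightarrow> y \<in> X \<Longrightarrow> s \<in> subdifferential (f i) y \<Longrightarrow> norm s \<le> B"
      "AE \<omega> in M. \<forall>i\<in>V. \<forall>k. norm (g i k \<omega>) \<le> B"
    and E: "\<And>k. E k \<subseteq> V \<times> V" "\<And>i k. i \<in> V \<Longrightarrow> (i, i) \<in> E k" "\<And>k. V \<times> V \<subseteq> (E k)\<^sup>*"
    and \<Omega>: "\<And>i k. i \<in> V \<Longrightarrow> \<Omega> i k \<in> measurable M (count_space (Idx i))"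
      "indep_vars (\<lambda>(i, k). count_space (Idx i)) (\<lambda>(i, k). \<Omega> i k) (V \<times> UNIV)"
    and x0: "\<And>i. i \<in> V \<Longrightarrow> x i 0 \<in> borel_measurable M"
      "indep_set (generated_sigma M V (\<lambda>_. borel) (\<lambda>i. x i 0))
        (generated_sigma M (V \<times> UNIV) (\<lambda>(i, k). count_space (Idx i)) (\<lambda>(i, k). \<Omega> i k))"
    and c: "0 < c" "\<And>i k y. i \<in> V
      \<Longrightarrow> (infdist y X)\<^sup>2 \<le> c * expectation (\<lambda>\<omega>. (infdist y (Xs i (\<Omega> i k \<omega>)))\<^sup>2)"
    and w: "\<And>i j k. i \<in> V \<Longrightarrow> j \<in> V \<Longrightarrow> 0 \<le> w i j k"
      "\<And>i j k. i \<in> V \<Longrightarrow> j \<in> V \<Longrightarrow> (i, j) \<notin> E k \<Longrightarrow> w i j k = 0"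
      "\<And>i k. i \<in> V \<Longrightarrow> (\<Sum>j\<in>V. w i j k) = 1"
      "\<And>j k. j \<in> V \<Longrightarrow> (\<Sum>i\<in>V. w i j k) = 1"
      "\<And>i j k. (i, j) \<in> E k \<Longrightarrow> wmin \<le> w i j k"
    and wmin: "0 < wmin" "wmin \<le> 1"
    and \<alpha>: "\<And>k. 0 < \<alpha> k" "summable (\<lambda>k. (\<alpha> k)\<^sup>2)"
    and g: "\<And>i k. i \<in> V \<Longrightarrow> g i k \<in> borel_measurable (history M V Idx x \<Omega> k)"
      "\<And>i k \<omega>. i \<in> V \<Longrightarrow> \<omega> \<in> space M \<Longrightarrow> g i k \<omega> \<in> subdifferential (f i) (weighted_state V E w x i k \<omega>)"
    and x_Suc: "\<And>i k \<omega>. i \<in> V \<Longrightarrow> \<omega> \<in> space M \<Longrightarrow> x i (Suc k) \<omega>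
      = closest_point (Xs i (\<Omega> i k \<omega>)) (weighted_state V E w x i k \<omega> - \<alpha> k *\<^sub>R g i k \<omega>)"
    and xstar: "xstar \<in> X" "\<And>y. y \<in> X \<Longrightarrow> (\<Sum>i\<in>V. f i xstar) \<le> (\<Sum>i\<in>V. f i y)"
begin

abbreviation "F \<equiv> history M V Idx x \<Omega>"
abbreviation "v \<equiv> weighted_state V E w x"
abbreviation "m \<equiv> real (card V)"

definition "infeas k \<omega> = (\<Sum>i\<in>V. (infdist (v i k \<omega>) X)\<^sup>2)"
definition "disagr k \<omega> = (\<Sum>i\<in>V. norm (v i k \<omega> - user_mean V (\<lambda>l. v l k \<omega>)))"
definition "gap k \<omega> = (\<Sum>i\<in>V. f i (user_mean V (\<lambda>i. closest_point X (v i k \<omega>)))) - (\<Sum>i\<in>V. f i xstar)"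
text \<open>The gain from projecting onto the random set, in the normalization of
  \<open>closest_point_step\<close>. It involves the index drawn at time \<open>k\<close>, so it
  enters the conditional inequalities through its conditional expectation.\<close>

definition "residual k \<omega> = (\<Sum>i\<in>V. (infdist (v i k \<omega>) (Xs i (\<Omega> i k \<omega>)))\<^sup>2 / 2)"
text \<open>Per user, 4 c B^2 comes from Young's inequality and 2 B^2 from the projection step; the
  added 1 keeps the constant positive when \<open>B = 0\<close>.\<close>

definition "C\<alpha> = m * ((4 * c + 2) * B\<^sup>2) + 1"

lemma m_pos: "0 < m" using V by (simp add: card_gt_0_iff)

lemma v_eq: "i \<in> V \<Longrightarrow> v i k \<omega> = (\<Sum>j\<in>V. w i j k *\<^sub>R x j k \<omega>)"
  unfolding weighted_state_def neighbours_def
  using V w(2) by (intro sum.mono_neutral_left) auto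

lemma sum_v_le:
  assumes "convex_on UNIV \<phi>"
  shows "(\<Sum>i\<in>V. \<phi> (v i k \<omega>)) \<le> (\<Sum>i\<in>V. \<phi> (x i k \<omega>))"
proof -
  have "(\<Sum>i\<in>V. \<phi> (v i k \<omega>)) = (\<Sum>i\<in>V. \<phi> (\<Sum>j\<in>V. w i j k *\<^sub>R x j k \<omega>))"
    by (simp add: v_eq)
  also have "\<dots> \<le> (\<Sum>i\<in>V. \<phi> (x i k \<omega>))"
    by (rule sum_convex_doubly_stochastic_le) (use V w assms in auto)
  finally show ?thesis .
qed

lemma X_nonempty: "X \<noteq> {}" using xstar by auto

lemma Xs_nonempty: "i \<in> V \<Longrightarrow> j \<in> Idx i \<Longrightarrow> Xs i j \<noteq> {}" using X(3) xstar(1) by blast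

lemma \<Omega>_in: "i \<in> V \<Longrightarrow> \<omega> \<in> space M \<Longrightarrow> \<Omega> i k \<omega> \<in> Idx i"
  using measurable_space[OF \<Omega>(1)] by simp

lemma projection_in_X: "closest_point X y \<in> X"
  using closest_point_in_set[OF X(1) X_nonempty] .

lemma infdist_X: "infdist y X = norm (y - closest_point X y)"
  using infdist_eq_dist_closest_point[OF X(1) X_nonempty] by (simp add: dist_norm)

text \<open>Convexity of \<open>X\<close> makes the averaged projections feasible, and feasibility
  is what makes \<open>gap\<close> nonnegative.\<close>

lemma mean_projection_in_X: "user_mean V (\<lambda>i. closest_point X (v i k \<omega>)) \<in> X"
proof -
  have "(\<Sum>i\<in>V. (1 / m) *\<^sub>R closest_point X (v i k \<omega>)) \<in> X"
    using V m_pos projection_in_X by (intro convex_sum[OF V(1) X(2)]) auto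
  then show ?thesis by (simp add: user_mean_def scaleR_sum_right)
qed

lemma nonneg: "0 \<le> infeas k \<omega>" "0 \<le> disagr k \<omega>" "0 \<le> gap k \<omega>" "0 \<le> residual k \<omega>"
  using xstar(2)[OF mean_projection_in_X[of k \<omega>]]
  by (auto simp: infeas_def disagr_def gap_def residual_def intro!: sum_nonneg)

lemma C\<alpha>_pos: "0 < C\<alpha>" unfolding C\<alpha>_def using m_pos c by (intro add_nonneg_pos mult_nonneg_nonneg) auto

section \<open>One-step estimates along a path\<close>

lemma step_le:
  assumes i: "i \<in> V" and \<omega>: "\<omega> \<in> space M" and gB: "norm (g i k \<omega>) \<le> B" and u: "u \<in> X"
  shows "(norm (x i (Suc k) \<omega> - u))\<^sup>2 + (infdist (v i k \<omega>) (Xs i (\<Omega> i k \<omega>)))\<^sup>2 / 2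
    \<le> (norm (v i k \<omega> - u))\<^sup>2 - 2 * \<alpha> k * (g i k \<omega> \<bullet> (v i k \<omega> - u)) + 2 * (\<alpha> k)\<^sup>2 * B\<^sup>2"
proof -
  have j: "\<Omega> i k \<omega> \<in> Idx i" using \<Omega>_in[OF i \<omega>] .
  have "(norm (x i (Suc k) \<omega> - u))\<^sup>2 + (infdist (v i k \<omega>) (Xs i (\<Omega> i k \<omega>)))\<^sup>2 / 2
    \<le> (norm (v i k \<omega> - u))\<^sup>2 - 2 * ((\<alpha> k *\<^sub>R g i k \<omega>) \<bullet> (v i k \<omega> - u)) + 2 * (norm (\<alpha> k *\<^sub>R g i k \<omega>))\<^sup>2"
    unfolding x_Suc[OF i \<omega>] using X(3)[OF i j] u by (intro closest_point_step Xs[OF i j]) auto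
  moreover have "(norm (\<alpha> k *\<^sub>R g i k \<omega>))\<^sup>2 \<le> (\<alpha> k)\<^sup>2 * B\<^sup>2"
    using gB by (auto simp: power_mult_distrib intro!: mult_left_mono power_mono)
  ultimately show ?thesis by (simp add: mult.assoc)
qed

text \<open>The coefficient 1 / (4c) is half of the 1 / (2c) that the regularity condition returns,
  so half of the gain survives.\<close>

lemma young: "2 * t * d \<le> d\<^sup>2 / (4 * c) + 4 * c * t\<^sup>2" for t d :: real
proof -
  have "0 \<le> (d - 4 * c * t)\<^sup>2 / (4 * c)" using c by simp
  also have "\<dots> = d\<^sup>2 / (4 * c) + 4 * c * t\<^sup>2 - 2 * t * d"
    using c by (simp add: field_simps power2_eq_square)
  finally show ?thesis by simp
qed

text \<open>The comparison point is the projection of v_i(k) onto \<open>X\<close>: its distance to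
  the new iterate bounds the new distance to \<open>X\<close>, and by Cauchy-Schwarz the subgradient
  term costs at most B d(v, X), which Young's inequality absorbs.\<close>

lemma infdist_step_le:
  assumes i: "i \<in> V" and \<omega>: "\<omega> \<in> space M" and gB: "norm (g i k \<omega>) \<le> B"
  shows "(infdist (x i (Suc k) \<omega>) X)\<^sup>2 + (infdist (v i k \<omega>) (Xs i (\<Omega> i k \<omega>)))\<^sup>2 / 2
    \<le> (infdist (v i k \<omega>) X)\<^sup>2 + (infdist (v i k \<omega>) X)\<^sup>2 / (4 * c) + (4 * c + 2) * B\<^sup>2 * (\<alpha> k)\<^sup>2"
proof -
  let ?z = "closest_point X (v i k \<omega>)"
  have "infdist (x i (Suc k) \<omega>) X \<le> norm (x i (Suc k) \<omega> - ?z)"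
    using infdist_le[OF projection_in_X] by (simp add: dist_norm)
  then have "(infdist (x i (Suc k) \<omega>) X)\<^sup>2 \<le> (norm (x i (Suc k) \<omega> - ?z))\<^sup>2"
    by (intro power_mono infdist_nonneg)
  moreover have "- (g i k \<omega> \<bullet> (v i k \<omega> - ?z)) \<le> B * infdist (v i k \<omega>) X"
    using Cauchy_Schwarz_ineq2[of "g i k \<omega>" "v i k \<omega> - ?z"] mult_right_mono[OF gB norm_ge_zero, of "v i k \<omega> - ?z"]
    by (simp add: infdist_X)
  then have "\<alpha> k * - (g i k \<omega> \<bullet> (v i k \<omega> - ?z)) \<le> \<alpha> k * (B * infdist (v i k \<omega>) X)"
    using \<alpha>(1)[of k] by (intro mult_left_mono) auto
  moreover note young[of "\<alpha> k * B" "infdist (v i k \<omega>) X"]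
  moreover note step_le[OF i \<omega> gB projection_in_X[of "v i k \<omega>"]]
  ultimately show ?thesis
    by (simp add: infdist_X[of "v i k \<omega>", symmetric] algebra_simps power_mult_distrib)
qed

text \<open>The subgradient inequality at v_i(k) produces f_i(v_i) - f_i(xstar). Two further
  comparisons, from v_i to z_i and from z_i to the mean projection, use subgradients at z_i and at
  the mean projection; both points lie in \<open>X\<close>, where \<open>B\<close> is a
  bound.\<close>

lemma objective_step_le:
  fixes k \<omega>
  defines "zbar \<equiv> user_mean V (\<lambda>i. closest_point X (v i k \<omega>))"
  assumes i: "i \<in> V" and \<omega>: "\<omega> \<in> space M" and gB: "norm (g i k \<omega>) \<le> B"
  shows "(norm (x i (Suc k) \<omega> - xstar))\<^sup>2 + (infdist (v i k \<omega>) (Xs i (\<Omega> i k \<omega>)))\<^sup>2 / 2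
    \<le> (norm (v i k \<omega> - xstar))\<^sup>2 + (infdist (v i k \<omega>) X)\<^sup>2 / (4 * c) + (4 * c + 2) * B\<^sup>2 * (\<alpha> k)\<^sup>2
      + 2 * \<alpha> k * B * norm (closest_point X (v i k \<omega>) - zbar) - 2 * \<alpha> k * (f i zbar - f i xstar)"
proof -
  let ?z = "closest_point X (v i k \<omega>)"
  have zbar: "zbar \<in> X" unfolding zbar_def by (rule mean_projection_in_X)
  have "f i (v i k \<omega>) + g i k \<omega> \<bullet> (xstar - v i k \<omega>) \<le> f i xstar"
    using g(2)[OF i \<omega>] by (simp add: subdifferential_def)
  then have "f i (v i k \<omega>) - f i xstar \<le> g i k \<omega> \<bullet> (v i k \<omega> - xstar)"
    by (simp add: inner_diff_right)
  moreover have "f i ?z - B * infdist (v i k \<omega>) X \<le> f i (v i k \<omega>)"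
    using subgradient_bound_lower[OF f_convex[OF i] B(2)[OF i projection_in_X]] by (simp add: infdist_X)
  moreover have "f i zbar - B * norm (?z - zbar) \<le> f i ?z"
    using subgradient_bound_lower[OF f_convex[OF i] B(2)[OF i zbar]] .
  ultimately have "f i zbar - f i xstar - B * norm (?z - zbar) - B * infdist (v i k \<omega>) X
      \<le> g i k \<omega> \<bullet> (v i k \<omega> - xstar)" by linarith
  then have "\<alpha> k * (f i zbar - f i xstar - B * norm (?z - zbar) - B * infdist (v i k \<omega>) X)
      \<le> \<alpha> k * (g i k \<omega> \<bullet> (v i k \<omega> - xstar))"
    using \<alpha>(1)[of k] by (intro mult_left_mono) auto
  moreover note young[of "\<alpha> k * B" "infdist (v i k \<omega>) X"]
  moreover note step_le[OF i \<omega> gB xstar(1)]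
  ultimately show ?thesis
    by (simp add: algebra_simps power_mult_distrib)
qed

text \<open>Projection onto \<open>X\<close> is nonexpansive, and two users differ by at most the
  sum of their deviations from the mean. Averaging over the second user gives each deviation plus
  their average, whence the factor 2.\<close>

lemma sum_projection_disagr_le:
  "(\<Sum>i\<in>V. norm (closest_point X (v i k \<omega>) - user_mean V (\<lambda>i. closest_point X (v i k \<omega>)))) \<le> 2 * disagr k \<omega>"
proof -
  define a where "a i = norm (v i k \<omega> - user_mean V (\<lambda>l. v l k \<omega>))" for i
  have "norm (closest_point X (v i k \<omega>) - user_mean V (\<lambda>i. closest_point X (v i k \<omega>)))
      \<le> a i + (\<Sum>j\<in>V. a j) / m" for i
  proof -
    have "norm (closest_point X (v i k \<omega>) - closest_point X (v j k \<omega>)) \<le> a i + a j" for j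
    proof -
      have "norm (closest_point X (v i k \<omega>) - closest_point X (v j k \<omega>)) \<le> norm (v i k \<omega> - v j k \<omega>)"
        using closest_point_lipschitz[OF X(2,1) X_nonempty] by (simp add: dist_norm)
      also have "\<dots> \<le> a i + a j"
        using norm_triangle_ineq4[of "v i k \<omega> - user_mean V (\<lambda>l. v l k \<omega>)" "v j k \<omega> - user_mean V (\<lambda>l. v l k \<omega>)"]
        by (simp add: a_def)
      finally show ?thesis .
    qed
    then have "norm (closest_point X (v i k \<omega>) - user_mean V (\<lambda>i. closest_point X (v i k \<omega>)))
        \<le> (\<Sum>j\<in>V. a i + a j) / m"
      by (intro norm_diff_user_mean_le V)
    also have "\<dots> = a i + (\<Sum>j\<in>V. a j) / m" using m_pos by (simp add: sum.distrib add_divide_distrib)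
    finally show ?thesis .
  qed
  then have "(\<Sum>i\<in>V. norm (closest_point X (v i k \<omega>) - user_mean V (\<lambda>i. closest_point X (v i k \<omega>))))
      \<le> (\<Sum>i\<in>V. a i + (\<Sum>j\<in>V. a j) / m)" by (rule sum_mono)
  also have "\<dots> = 2 * disagr k \<omega>" using m_pos by (simp add: sum.distrib disagr_def a_def)
  finally show ?thesis .
qed

lemma sum_infdist_step_le:
  assumes \<omega>: "\<omega> \<in> space M" and gB: "\<And>i. i \<in> V \<Longrightarrow> norm (g i k \<omega>) \<le> B"
  shows "(\<Sum>i\<in>V. (infdist (x i (Suc k) \<omega>) X)\<^sup>2) + residual k \<omega>
    \<le> (\<Sum>i\<in>V. (infdist (x i k \<omega>) X)\<^sup>2) + infeas k \<omega> / (4 * c) + C\<alpha> * (\<alpha> k)\<^sup>2"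
proof -
  have "(\<Sum>i\<in>V. (infdist (x i (Suc k) \<omega>) X)\<^sup>2) + residual k \<omega>
      = (\<Sum>i\<in>V. (infdist (x i (Suc k) \<omega>) X)\<^sup>2 + (infdist (v i k \<omega>) (Xs i (\<Omega> i k \<omega>)))\<^sup>2 / 2)"
    by (simp add: residual_def sum.distrib)
  also have "\<dots> \<le> (\<Sum>i\<in>V. (infdist (v i k \<omega>) X)\<^sup>2 + (infdist (v i k \<omega>) X)\<^sup>2 / (4 * c) + (4 * c + 2) * B\<^sup>2 * (\<alpha> k)\<^sup>2)"
    using infdist_step_le[OF _ \<omega> gB] by (intro sum_mono) auto
  also have "\<dots> = (\<Sum>i\<in>V. (infdist (v i k \<omega>) X)\<^sup>2) + infeas k \<omega> / (4 * c) + m * ((4 * c + 2) * B\<^sup>2) * (\<alpha> k)\<^sup>2"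
    by (simp add: sum.distrib infeas_def sum_divide_distrib)
  also have "(\<Sum>i\<in>V. (infdist (v i k \<omega>) X)\<^sup>2) \<le> (\<Sum>i\<in>V. (infdist (x i k \<omega>) X)\<^sup>2)"
    using convex_on_infdist_power2[OF X(1,2) X_nonempty] by (rule sum_v_le)
  also have "m * ((4 * c + 2) * B\<^sup>2) * (\<alpha> k)\<^sup>2 \<le> C\<alpha> * (\<alpha> k)\<^sup>2"
    by (intro mult_right_mono) (auto simp: C\<alpha>_def)
  finally show ?thesis by simp
qed

lemma sum_objective_step_le:
  assumes \<omega>: "\<omega> \<in> space M" and gB: "\<And>i. i \<in> V \<Longrightarrow> norm (g i k \<omega>) \<le> B"
  shows "(\<Sum>i\<in>V. (norm (x i (Suc k) \<omega> - xstar))\<^sup>2) + residual k \<omega>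
    \<le> (\<Sum>i\<in>V. (norm (x i k \<omega> - xstar))\<^sup>2) + infeas k \<omega> / (4 * c) + C\<alpha> * (\<alpha> k)\<^sup>2
      + (4 * B + 1) * (\<alpha> k * disagr k \<omega>) - 2 * (\<alpha> k * gap k \<omega>)"
proof -
  define zbar where "zbar = user_mean V (\<lambda>i. closest_point X (v i k \<omega>))"
  have "(\<Sum>i\<in>V. (norm (x i (Suc k) \<omega> - xstar))\<^sup>2) + residual k \<omega>
      = (\<Sum>i\<in>V. (norm (x i (Suc k) \<omega> - xstar))\<^sup>2 + (infdist (v i k \<omega>) (Xs i (\<Omega> i k \<omega>)))\<^sup>2 / 2)"
    by (simp add: residual_def sum.distrib)
  also have "\<dots> \<le> (\<Sum>i\<in>V. (norm (v i k \<omega> - xstar))\<^sup>2 + (infdist (v i k \<omega>) X)\<^sup>2 / (4 * c)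
      + (4 * c + 2) * B\<^sup>2 * (\<alpha> k)\<^sup>2 + 2 * \<alpha> k * B * norm (closest_point X (v i k \<omega>) - zbar)
      - 2 * \<alpha> k * (f i zbar - f i xstar))"
    unfolding zbar_def using objective_step_le[OF _ \<omega> gB] by (intro sum_mono) auto
  also have "\<dots> = (\<Sum>i\<in>V. (norm (v i k \<omega> - xstar))\<^sup>2) + infeas k \<omega> / (4 * c)
      + m * ((4 * c + 2) * B\<^sup>2) * (\<alpha> k)\<^sup>2
      + 2 * \<alpha> k * B * (\<Sum>i\<in>V. norm (closest_point X (v i k \<omega>) - zbar)) - 2 * (\<alpha> k * gap k \<omega>)"
    by (simp add: sum.distrib sum_subtractf infeas_def gap_def zbar_def sum_divide_distrib sum_distrib_left
        right_diff_distrib mult.assoc)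
  also have "(\<Sum>i\<in>V. (norm (v i k \<omega> - xstar))\<^sup>2) \<le> (\<Sum>i\<in>V. (norm (x i k \<omega> - xstar))\<^sup>2)"
    using convex_on_norm_diff_power2 by (rule sum_v_le)
  also have "m * ((4 * c + 2) * B\<^sup>2) * (\<alpha> k)\<^sup>2 \<le> C\<alpha> * (\<alpha> k)\<^sup>2"
    by (intro mult_right_mono) (auto simp: C\<alpha>_def)
  also have "2 * \<alpha> k * B * (\<Sum>i\<in>V. norm (closest_point X (v i k \<omega>) - zbar)) \<le> 2 * \<alpha> k * B * (2 * disagr k \<omega>)"
    unfolding zbar_def using sum_projection_disagr_le \<alpha>(1)[of k] B(1) by (intro mult_left_mono) auto
  \<comment> \<open>\<open>4 * B\<close> is all that the estimate requires; the extra 1 makes the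
    constant positive also for \<open>B = 0\<close>.\<close>
  also have "\<dots> \<le> (4 * B + 1) * (\<alpha> k * disagr k \<omega>)"
    using mult_nonneg_nonneg[OF less_imp_le[OF \<alpha>(1)[of k]] nonneg(2)[of k \<omega>]] by (simp add: algebra_simps)
  finally show ?thesis by simp
qed

section \<open>Contraction of the disagreement\<close>

definition "rate = wmin / (2 * m ^ 5)"

lemma rate: "0 < rate" "rate \<le> 1"
proof -
  have "1 \<le> m" using m_pos by simp
  then have m5: "1 \<le> m ^ 5" by (rule one_le_power)
  then show "0 < rate" unfolding rate_def using wmin(1) by (intro divide_pos_pos) linarith+
  have "wmin \<le> 2 * m ^ 5" using wmin(2) m5 by linarith
  then show "rate \<le> 1" unfolding rate_def using m5 by (subst pos_divide_le_eq) linarith+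
qed

text \<open>The squared counterpart of \<open>disagr\<close>: the contraction by averaging is
  available for sums of squares.\<close>

definition "spread k \<omega> = (\<Sum>i\<in>V. (norm (v i k \<omega> - user_mean V (\<lambda>l. v l k \<omega>)))\<^sup>2)"

lemma spread_nonneg: "0 \<le> spread k \<omega>" by (auto simp: spread_def intro!: sum_nonneg)

text \<open>The mean minimizes the sum of squared distances, so the centre is free. The recursion
  takes for it the mean of the previous v_i, and the initial estimate takes
  \<open>xstar\<close>.\<close>

lemma spread_le:
  "spread k \<omega> \<le> (1 - rate) * (\<Sum>i\<in>V. (norm (x i k \<omega> - a))\<^sup>2)"
proof -
  have "spread k \<omega> = (\<Sum>i\<in>V. (norm ((\<Sum>j\<in>V. w i j k *\<^sub>R x j k \<omega>)
      - user_mean V (\<lambda>i. \<Sum>j\<in>V. w i j k *\<^sub>R x j k \<omega>)))\<^sup>2)"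
    by (simp add: spread_def v_eq user_mean_def)
  also have "\<dots> \<le> (1 - rate) * (\<Sum>i\<in>V. (norm (x i k \<omega> - user_mean V (\<lambda>i. x i k \<omega>)))\<^sup>2)"
    unfolding rate_def by (rule doubly_stochastic_contraction[where R = "E k"]) (use V E w wmin in auto)
  also have "\<dots> \<le> (1 - rate) * (\<Sum>i\<in>V. (norm (x i k \<omega> - a))\<^sup>2)"
    using rate by (intro mult_left_mono sum_norm_diff_user_mean_le V) auto
  finally show ?thesis .
qed

text \<open>The projection of v_i(k) onto \<open>X\<close> belongs to the random set and is fixed by
  the projection onto it. Nonexpansiveness around this point leads to 2 d(v, X) + B \<alpha>, and
  squaring a sum of two terms gives the factors 8 and 2.\<close>

lemma step_error_le:
  assumes i: "i \<in> V" and \<omega>: "\<omega> \<in> space M" and gB: "norm (g i k \<omega>) \<le> B"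
  shows "(norm (x i (Suc k) \<omega> - v i k \<omega>))\<^sup>2 \<le> 8 * (infdist (v i k \<omega>) X)\<^sup>2 + 2 * B\<^sup>2 * (\<alpha> k)\<^sup>2"
proof -
  let ?z = "closest_point X (v i k \<omega>)" and ?C = "Xs i (\<Omega> i k \<omega>)"
  have j: "\<Omega> i k \<omega> \<in> Idx i" using \<Omega>_in[OF i \<omega>] .
  have zC: "?z \<in> ?C" using X(3)[OF i j] projection_in_X by blast
  have ag: "norm (\<alpha> k *\<^sub>R g i k \<omega>) \<le> B * \<alpha> k" using gB \<alpha>(1)[of k] by (simp add: mult.commute)
  have "norm (x i (Suc k) \<omega> - ?z) \<le> norm (v i k \<omega> - \<alpha> k *\<^sub>R g i k \<omega> - ?z)"
    using closest_point_lipschitz[OF Xs(2,1)[OF i j] Xs_nonempty[OF i j], of _ ?z] zC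
    by (simp add: x_Suc[OF i \<omega>] dist_norm closest_point_self)
  also have "\<dots> \<le> norm (v i k \<omega> - ?z) + B * \<alpha> k"
    using norm_triangle_ineq4[of "v i k \<omega> - ?z" "\<alpha> k *\<^sub>R g i k \<omega>"] ag by (simp add: algebra_simps)
  finally have "norm (x i (Suc k) \<omega> - v i k \<omega>) \<le> 2 * infdist (v i k \<omega>) X + B * \<alpha> k"
    using norm_triangle_ineq4[of "x i (Suc k) \<omega> - ?z" "v i k \<omega> - ?z"] by (simp add: infdist_X)
  then have "(norm (x i (Suc k) \<omega> - v i k \<omega>))\<^sup>2 \<le> (2 * infdist (v i k \<omega>) X + B * \<alpha> k)\<^sup>2"
    by (intro power_mono) auto
  also have "\<dots> \<le> 8 * (infdist (v i k \<omega>) X)\<^sup>2 + 2 * B\<^sup>2 * (\<alpha> k)\<^sup>2"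
    using sum_squares_bound[of "2 * infdist (v i k \<omega>) X" "B * \<alpha> k"] by (simp add: power2_sum power_mult_distrib)
  finally show ?thesis .
qed

text \<open>Young's parameter equals the contraction rate, so that the factors combine to (1 -
  rate)(1 + rate) = 1 - rate^2 < 1. The next iterates are measured from the old mean.\<close>

lemma spread_Suc_le:
  assumes \<omega>: "\<omega> \<in> space M" and gB: "\<And>i. i \<in> V \<Longrightarrow> norm (g i k \<omega>) \<le> B"
  shows "spread (Suc k) \<omega> \<le> (1 - rate\<^sup>2) * spread k \<omega>
    + (1 + 1 / rate) * (8 * infeas k \<omega> + 2 * m * B\<^sup>2 * (\<alpha> k)\<^sup>2)"
proof -
  let ?b = "user_mean V (\<lambda>l. v l k \<omega>)"
  have "(norm (x i (Suc k) \<omega> - ?b))\<^sup>2 \<le> (1 + rate) * (norm (v i k \<omega> - ?b))\<^sup>2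
      + (1 + 1 / rate) * (8 * (infdist (v i k \<omega>) X)\<^sup>2 + 2 * B\<^sup>2 * (\<alpha> k)\<^sup>2)" if i: "i \<in> V" for i
  proof -
    have "(norm (x i (Suc k) \<omega> - ?b))\<^sup>2 \<le> (1 + rate) * (norm (v i k \<omega> - ?b))\<^sup>2
        + (1 + 1 / rate) * (norm (x i (Suc k) \<omega> - v i k \<omega>))\<^sup>2"
      using norm_add_power2_le[OF rate(1), of "v i k \<omega> - ?b" "x i (Suc k) \<omega> - v i k \<omega>"] by simp
    also have "\<dots> \<le> (1 + rate) * (norm (v i k \<omega> - ?b))\<^sup>2
        + (1 + 1 / rate) * (8 * (infdist (v i k \<omega>) X)\<^sup>2 + 2 * B\<^sup>2 * (\<alpha> k)\<^sup>2)"
      using rate by (intro add_left_mono mult_left_mono step_error_le[OF i \<omega> gB[OF i]]) auto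
    finally show ?thesis .
  qed
  then have "(\<Sum>i\<in>V. (norm (x i (Suc k) \<omega> - ?b))\<^sup>2) \<le> (\<Sum>i\<in>V. (1 + rate) * (norm (v i k \<omega> - ?b))\<^sup>2
      + (1 + 1 / rate) * (8 * (infdist (v i k \<omega>) X)\<^sup>2 + 2 * B\<^sup>2 * (\<alpha> k)\<^sup>2))"
    by (rule sum_mono)
  also have "\<dots> = (1 + rate) * spread k \<omega>
      + (1 + 1 / rate) * (8 * infeas k \<omega> + 2 * m * B\<^sup>2 * (\<alpha> k)\<^sup>2)"
    by (simp add: spread_def infeas_def sum.distrib flip: sum_distrib_left)
  finally have "(1 - rate) * (\<Sum>i\<in>V. (norm (x i (Suc k) \<omega> - ?b))\<^sup>2) \<le> (1 - rate) * ((1 + rate) * spread k \<omega>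
      + (1 + 1 / rate) * (8 * infeas k \<omega> + 2 * m * B\<^sup>2 * (\<alpha> k)\<^sup>2))"
    using rate by (intro mult_left_mono) auto
  also have "\<dots> = (1 - rate\<^sup>2) * spread k \<omega>
      + (1 - rate) * ((1 + 1 / rate) * (8 * infeas k \<omega> + 2 * m * B\<^sup>2 * (\<alpha> k)\<^sup>2))"
    by (simp add: algebra_simps power2_eq_square)
  also have "(1 - rate) * ((1 + 1 / rate) * (8 * infeas k \<omega> + 2 * m * B\<^sup>2 * (\<alpha> k)\<^sup>2))
      \<le> (1 + 1 / rate) * (8 * infeas k \<omega> + 2 * m * B\<^sup>2 * (\<alpha> k)\<^sup>2)"
    using rate nonneg(1)[of k \<omega>] m_pos by (intro mult_left_le_one_le mult_nonneg_nonneg add_nonneg_nonneg) auto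
  finally show ?thesis using spread_le[of "Suc k" \<omega> ?b] by linarith
qed

definition "S0 \<omega> = (\<Sum>i\<in>V. (norm (x i 0 \<omega> - xstar))\<^sup>2)"

lemma S0_nonneg: "0 \<le> S0 \<omega>" by (auto simp: S0_def intro!: sum_nonneg)

text \<open>Each product of the step size with a deviation is at most the sum of their squares, so
  summing \<open>spread\<close> is enough. \<open>K\<close> depends neither on the outcome nor on
  \<open>n\<close>; therefore the bound can be integrated against the weight and then passed to the
  limit.\<close>

lemma sum_disagr_le:
  "\<exists>K\<ge>0. \<forall>\<omega>\<in>space M. (\<forall>i\<in>V. \<forall>k. norm (g i k \<omega>) \<le> B) \<longrightarrow> (\<forall>n.
    (\<Sum>k<n. \<alpha> k * disagr k \<omega>) \<le> K * (S0 \<omega> + (\<Sum>k<n. (\<alpha> k)\<^sup>2) + (\<Sum>k<n. infeas k \<omega>)))"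
proof -
  define A where "A = 1 + 1 / rate"
  have A: "0 \<le> A" using rate by (simp add: A_def)
  \<comment> \<open>The sum of the three nonnegative coefficients that arise below, hence at least
    as large as each of them.\<close>
  define K where "K = 1 / rate\<^sup>2 + 8 * A / rate\<^sup>2 + (A * (2 * m * B\<^sup>2) / rate\<^sup>2 + m)"
  have K: "0 \<le> K" "1 / rate\<^sup>2 \<le> K" "8 * A / rate\<^sup>2 \<le> K" "A * (2 * m * B\<^sup>2) / rate\<^sup>2 + m \<le> K"
    using A rate m_pos by (auto simp: K_def)
  have "(\<Sum>k<n. \<alpha> k * disagr k \<omega>) \<le> K * (S0 \<omega> + (\<Sum>k<n. (\<alpha> k)\<^sup>2) + (\<Sum>k<n. infeas k \<omega>))"
    if \<omega>: "\<omega> \<in> space M" and gB: "\<forall>i\<in>V. \<forall>k. norm (g i k \<omega>) \<le> B" for \<omega> n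
  proof -
    have "\<alpha> k * disagr k \<omega> \<le> m * (\<alpha> k)\<^sup>2 + spread k \<omega>" for k
    proof -
      have "\<alpha> k * disagr k \<omega> = (\<Sum>i\<in>V. \<alpha> k * norm (v i k \<omega> - user_mean V (\<lambda>l. v l k \<omega>)))"
        by (simp add: disagr_def sum_distrib_left)
      also have "\<dots> \<le> (\<Sum>i\<in>V. (\<alpha> k)\<^sup>2 + (norm (v i k \<omega> - user_mean V (\<lambda>l. v l k \<omega>)))\<^sup>2)"
      proof (rule sum_mono)
        fix i
        let ?d = "norm (v i k \<omega> - user_mean V (\<lambda>l. v l k \<omega>))"
        have "0 \<le> \<alpha> k * ?d" using \<alpha>(1)[of k] by simp
        then show "\<alpha> k * ?d \<le> (\<alpha> k)\<^sup>2 + ?d\<^sup>2" using sum_squares_bound[of "\<alpha> k" ?d] by linarith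
      qed
      finally show ?thesis by (simp add: spread_def sum.distrib)
    qed
    then have "(\<Sum>k<n. \<alpha> k * disagr k \<omega>) \<le> (\<Sum>k<n. m * (\<alpha> k)\<^sup>2 + spread k \<omega>)" by (rule sum_mono)
    also have "\<dots> = m * (\<Sum>k<n. (\<alpha> k)\<^sup>2) + (\<Sum>k<n. spread k \<omega>)"
      by (simp add: sum.distrib sum_distrib_left)
    also have "(\<Sum>k<n. spread k \<omega>) \<le> (spread 0 \<omega>
        + (\<Sum>k<n. A * (8 * infeas k \<omega> + 2 * m * B\<^sup>2 * (\<alpha> k)\<^sup>2))) / (1 - (1 - rate\<^sup>2))"
    proof (rule perturbed_contraction_sum_le)
      show "0 \<le> 1 - rate\<^sup>2" "1 - rate\<^sup>2 < 1" using rate by (auto simp: power_le_one)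
      show "spread (Suc k) \<omega> \<le> (1 - rate\<^sup>2) * spread k \<omega> + A * (8 * infeas k \<omega> + 2 * m * B\<^sup>2 * (\<alpha> k)\<^sup>2)" for k
        unfolding A_def using spread_Suc_le[OF \<omega>] gB by blast
      show "0 \<le> A * (8 * infeas k \<omega> + 2 * m * B\<^sup>2 * (\<alpha> k)\<^sup>2)" for k
        using A nonneg(1)[of k \<omega>] m_pos by simp
    qed (rule spread_nonneg)
    also have "\<dots> = spread 0 \<omega> / rate\<^sup>2 + 8 * A / rate\<^sup>2 * (\<Sum>k<n. infeas k \<omega>)
        + A * (2 * m * B\<^sup>2) / rate\<^sup>2 * (\<Sum>k<n. (\<alpha> k)\<^sup>2)"
    proof -
      have "(\<Sum>k<n. A * (8 * infeas k \<omega> + 2 * m * B\<^sup>2 * (\<alpha> k)\<^sup>2))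
          = 8 * A * (\<Sum>k<n. infeas k \<omega>) + A * (2 * m * B\<^sup>2) * (\<Sum>k<n. (\<alpha> k)\<^sup>2)"
        by (simp add: sum.distrib distrib_left sum_distrib_left mult_ac)
      then show ?thesis by (simp add: add_divide_distrib)
    qed
    also have "spread 0 \<omega> \<le> S0 \<omega>"
    proof -
      have "spread 0 \<omega> \<le> (1 - rate) * S0 \<omega>" unfolding S0_def by (rule spread_le)
      also have "\<dots> \<le> S0 \<omega>" using rate S0_nonneg by (intro mult_left_le_one_le) auto
      finally show ?thesis .
    qed
    finally have "(\<Sum>k<n. \<alpha> k * disagr k \<omega>) \<le> 1 / rate\<^sup>2 * S0 \<omega>
        + (A * (2 * m * B\<^sup>2) / rate\<^sup>2 + m) * (\<Sum>k<n. (\<alpha> k)\<^sup>2) + 8 * A / rate\<^sup>2 * (\<Sum>k<n. infeas k \<omega>)"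
      by (simp add: divide_right_mono algebra_simps)
    also have "\<dots> \<le> K * S0 \<omega> + K * (\<Sum>k<n. (\<alpha> k)\<^sup>2) + K * (\<Sum>k<n. infeas k \<omega>)"
      using K S0_nonneg nonneg(1) by (intro add_mono mult_right_mono sum_nonneg) auto
    finally show ?thesis by (simp add: distrib_left)
  qed
  then show ?thesis using K(1) by blast
qed

section \<open>The filtration, adaptedness and independence\<close>

lemma space_F: "space (F k) = space M"
  by (simp add: history_def space_measure_of_conv)

lemma sets_F: "sets (F k) = sigma_sets (space M)
    (generated_sigma M V (\<lambda>_. borel) (\<lambda>i. x i 0) \<union>
     generated_sigma M (V \<times> {..<k}) (\<lambda>(i, l). count_space (Idx i)) (\<lambda>(i, l). \<Omega> i l))"
  unfolding history_def by (intro sets_measure_of Un_least generated_sigma_subset_Pow)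

lemma subalgebra_F: "subalgebra M (F k)"
proof -
  have "generated_sigma M V (\<lambda>_. borel) (\<lambda>i. x i 0) \<subseteq> events"
    using x0(1) by (rule generated_sigma_subset_sets)
  moreover have "generated_sigma M (V \<times> {..<k}) (\<lambda>(i, l). count_space (Idx i)) (\<lambda>(i, l). \<Omega> i l) \<subseteq> events"
    using \<Omega>(1) by (intro generated_sigma_subset_sets) auto
  ultimately show ?thesis
    unfolding subalgebra_def space_F sets_F by (auto intro!: sets.sigma_sets_subset)
qed

lemmas F_measurable_imp = measurable_from_subalg[OF subalgebra_F]

lemma F_mono: "k \<le> k' \<Longrightarrow> sets (F k) \<subseteq> sets (F k')"
  unfolding sets_F by (intro sigma_sets_subseteq Un_mono generated_sigma_mono order_refl) auto

lemma F_measurable_mono: "k \<le> k' \<Longrightarrow> u \<in> measurable (F k) N \<Longrightarrow> u \<in> measurable (F k') N"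
  using F_mono[of k k'] by (auto simp: measurable_def space_F)

lemma generated_in_F:
  assumes i: "i \<in> V"
  shows "x i 0 \<in> borel_measurable (F k)"
    and "l < k \<Longrightarrow> \<Omega> i l \<in> measurable (F k) (count_space (Idx i))"
proof -
  show "x i 0 \<in> borel_measurable (F k)"
  proof (rule measurableI)
    fix A :: "'a set" assume "A \<in> sets borel"
    then have "x i 0 -` A \<inter> space M \<in> generated_sigma M V (\<lambda>_. borel) (\<lambda>i. x i 0)"
      unfolding generated_sigma_def using i by (intro sigma_sets.Basic) auto
    then show "x i 0 -` A \<inter> space (F k) \<in> sets (F k)"
      unfolding sets_F space_F by (intro sigma_sets.Basic) auto
  qed simp
  show "\<Omega> i l \<in> measurable (F k) (count_space (Idx i))" if "l < k"
  proof (rule measurableI)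
    fix A assume "A \<in> sets (count_space (Idx i))"
    then have "\<Omega> i l -` A \<inter> space M
        \<in> generated_sigma M (V \<times> {..<k}) (\<lambda>(i, l). count_space (Idx i)) (\<lambda>(i, l). \<Omega> i l)"
      unfolding generated_sigma_def using i that by (intro sigma_sets.Basic) force
    then show "\<Omega> i l -` A \<inter> space (F k) \<in> sets (F k)"
      unfolding sets_F space_F by (intro sigma_sets.Basic) auto
  qed (use \<Omega>_in i in \<open>simp add: space_F\<close>)
qed

lemma v_measurable_if:
  assumes "\<And>j. j \<in> V \<Longrightarrow> x j k \<in> borel_measurable N"
  shows "v i k \<in> borel_measurable N"
proof -
  have "(\<lambda>\<omega>. \<Sum>j\<in>neighbours V E i k. w i j k *\<^sub>R x j k \<omega>) \<in> borel_measurable N"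
    using assms by (intro borel_measurable_sum borel_measurable_scaleR) (auto simp: neighbours_def)
  then show ?thesis by (simp add: weighted_state_def[abs_def])
qed

text \<open>\<open>v i k\<close> and \<open>g i k\<close> are known at time \<open>k\<close>,
  whereas \<open>\<Omega> i k\<close> enters the history only at time \<open>Suc k\<close>; the new
  iterate is therefore adapted with exactly this shift.\<close>

lemma x_measurable: "i \<in> V \<Longrightarrow> x i k \<in> borel_measurable (F k)"
proof (induction k arbitrary: i)
  case 0
  then show ?case by (rule generated_in_F)
next
  case (Suc k)
  have [measurable]: "v i k \<in> borel_measurable (F (Suc k))" "g i k \<in> borel_measurable (F (Suc k))"
    using v_measurable_if[OF Suc.IH] g(1)[OF Suc.prems] F_measurable_mono[of k "Suc k"] by auto
  have "(\<lambda>\<omega>. closest_point (Xs i (\<Omega> i k \<omega>)) (v i k \<omega> - \<alpha> k *\<^sub>R g i k \<omega>)) \<in> borel_measurable (F (Suc k))"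
  \<comment> \<open>For each fixed index the projection is continuous; the finitely many pieces are
    glued along the measurable index.\<close>
  proof (rule measurable_compose_countable'[where I = "Idx i"
        and f = "\<lambda>j \<omega>. closest_point (Xs i j) (v i k \<omega> - \<alpha> k *\<^sub>R g i k \<omega>)"])
    fix j assume j: "j \<in> Idx i"
    have [measurable]: "closest_point (Xs i j) \<in> borel_measurable borel"
      using Suc.prems j by (intro borel_measurable_continuous_onI continuous_on_closest_point Xs Xs_nonempty)
    show "(\<lambda>\<omega>. closest_point (Xs i j) (v i k \<omega> - \<alpha> k *\<^sub>R g i k \<omega>)) \<in> borel_measurable (F (Suc k))"
      by measurable
  qed (use generated_in_F(2)[OF Suc.prems, of k "Suc k"] Idx[OF Suc.prems] in \<open>auto intro: countable_finite\<close>)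
  then show ?case
    by (subst measurable_cong) (auto simp: space_F x_Suc[OF Suc.prems])
qed

lemma v_measurable[measurable]: "v i k \<in> borel_measurable (F k)"
  using x_measurable by (rule v_measurable_if)

lemma infdist_measurable[measurable]: "(\<lambda>y. infdist y C) \<in> borel_measurable borel"
  by (intro borel_measurable_continuous_onI continuous_intros)

lemma closest_point_X_measurable[measurable]: "closest_point X \<in> borel_measurable borel"
  by (intro borel_measurable_continuous_onI continuous_on_closest_point X X_nonempty)

lemma user_mean_measurable:
  "(\<And>i. i \<in> V \<Longrightarrow> u i \<in> borel_measurable N)
    \<Longrightarrow> (\<lambda>\<omega>. user_mean V (\<lambda>i. u i \<omega>) :: 'a) \<in> borel_measurable N"
  unfolding user_mean_def by measurable

lemma terms_measurable[measurable]:
  "infeas k \<in> borel_measurable (F k)" "disagr k \<in> borel_measurable (F k)" "gap k \<in> borel_measurable (F k)"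
proof -
  have [measurable]: "(\<lambda>\<omega>. user_mean V (\<lambda>l. v l k \<omega>)) \<in> borel_measurable (F k)"
      "(\<lambda>\<omega>. user_mean V (\<lambda>l. closest_point X (v l k \<omega>))) \<in> borel_measurable (F k)"
    by (rule user_mean_measurable; measurable)+
  show "infeas k \<in> borel_measurable (F k)" "disagr k \<in> borel_measurable (F k)"
    unfolding infeas_def[abs_def] disagr_def[abs_def] by measurable
  have f[measurable]: "f i \<in> borel_measurable borel" if "i \<in> V" for i
    using convex_on_continuous[OF open_UNIV f_convex[OF that]] by (rule borel_measurable_continuous_onI)
  have "(\<lambda>\<omega>. f i (user_mean V (\<lambda>l. closest_point X (v l k \<omega>)))) \<in> borel_measurable (F k)" if "i \<in> V" for i
    using that by measurable
  then show "gap k \<in> borel_measurable (F k)"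
    unfolding gap_def[abs_def] by (intro borel_measurable_diff borel_measurable_sum) auto
qed

lemma S0_measurable: "S0 \<in> borel_measurable (F k)"
  unfolding S0_def[abs_def] using generated_in_F(1) by measurable

text \<open>Past indices and the current index of user \<open>i\<close> are disjoint blocks of one
  independent family, and the initial points are independent of the whole family. Together these
  make the current index independent of the history.\<close>

lemma indep_history:
  assumes i: "i \<in> V" and A: "A \<in> sets (F k)" and j: "j \<in> Idx i"
  shows "prob (A \<inter> {\<omega>\<in>space M. \<Omega> i k \<omega> = j}) = prob A * prob {\<omega>\<in>space M. \<Omega> i k \<omega> = j}"
proof -
  let ?gen = "\<lambda>J. generated_sigma M J (\<lambda>(i, l). count_space (Idx i)) (\<lambda>(i, l). \<Omega> i l)"
  \<comment> \<open>The past block stops strictly before \<open>k\<close>, which keeps it disjoint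
    from the singleton block.\<close>
  let ?I = "case_bool (V \<times> {..<k}) {(i, k)}"
  have "indep_sets (\<lambda>b. sigma_sets (space M) (\<Union>p\<in>?I b.
      {(case p of (i, l) \<Rightarrow> \<Omega> i l) -` A \<inter> space M | A. A \<in> sets (case p of (i, l) \<Rightarrow> count_space (Idx i))})) UNIV"
  proof (rule indep_sets_collect_sigma)
    show "indep_sets (\<lambda>p. {(case p of (i, l) \<Rightarrow> \<Omega> i l) -` A \<inter> space M | A.
        A \<in> sets (case p of (i, l) \<Rightarrow> count_space (Idx i))}) (\<Union>b\<in>UNIV. ?I b)"
      using \<Omega>(2) unfolding indep_vars_def2
      by (elim conjE, elim indep_sets_mono_index[rotated]) (use i in \<open>auto simp: UNIV_bool\<close>)
    fix b p assume "p \<in> ?I b"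
    show "Int_stable {(case p of (i, l) \<Rightarrow> \<Omega> i l) -` A \<inter> space M | A. A \<in> sets (case p of (i, l) \<Rightarrow> count_space (Idx i))}"
    proof (rule Int_stableI, safe)
      fix A A' assume "A \<in> sets (case p of (i, l) \<Rightarrow> count_space (Idx i))"
        "A' \<in> sets (case p of (i, l) \<Rightarrow> count_space (Idx i))"
      then show "\<exists>B. (case p of (i, l) \<Rightarrow> \<Omega> i l) -` A \<inter> space M \<inter> ((case p of (i, l) \<Rightarrow> \<Omega> i l) -` A' \<inter> space M)
          = (case p of (i, l) \<Rightarrow> \<Omega> i l) -` B \<inter> space M \<and> B \<in> sets (case p of (i, l) \<Rightarrow> count_space (Idx i))"
        by (intro exI[of _ "A \<inter> A'"]) auto
    qed
  next
    show "disjoint_family_on ?I UNIV" by (auto simp: disjoint_family_on_def split: bool.split)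
  qed
  then have "indep_set (?gen (V \<times> {..<k})) (?gen {(i, k)})"
    unfolding indep_set_def generated_sigma_def
    by (rule back_subst[of "\<lambda>G. indep_sets G UNIV"]) (intro ext, auto split: bool.split)
  with x0(2) have "indep_set (sets (F k)) (?gen {(i, k)})"
    unfolding sets_F
    by (rule indep_set_generated_by_Un)
      (use i in \<open>auto intro!: sigma_algebra_generated_sigma generated_sigma_mono
        algebra.Int_stable sigma_algebra.axioms(1)\<close>)
  moreover have "\<Omega> i k -` {j} \<inter> space M \<in> ?gen {(i, k)}"
    unfolding generated_sigma_def using j by (intro sigma_sets.Basic) auto
  ultimately have "prob (A \<inter> (\<Omega> i k -` {j} \<inter> space M)) = prob A * prob (\<Omega> i k -` {j} \<inter> space M)"
    using A by (intro indep_setD)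
  moreover have "\<Omega> i k -` {j} \<inter> space M = {\<omega>\<in>space M. \<Omega> i k \<omega> = j}" by auto
  ultimately show ?thesis by simp
qed

section \<open>Conditional one-step inequalities\<close>

lemma residual_term_measurable:
  assumes i: "i \<in> V"
  shows "(\<lambda>\<omega>. (infdist (v i k \<omega>) (Xs i (\<Omega> i k \<omega>)))\<^sup>2 / 2) \<in> borel_measurable M"
proof (rule measurable_compose_countable'[where I = "Idx i"
      and f = "\<lambda>j \<omega>. (infdist (v i k \<omega>) (Xs i j))\<^sup>2 / 2"])
  have [measurable]: "v i k \<in> borel_measurable M" by (rule F_measurable_imp[OF v_measurable])
  show "(\<lambda>\<omega>. (infdist (v i k \<omega>) (Xs i j))\<^sup>2 / 2) \<in> borel_measurable M" for j by measurable
qed (use \<Omega>(1)[OF i] Idx[OF i] in \<open>auto intro: countable_finite\<close>)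

lemma residual_measurable: "residual k \<in> borel_measurable M"
  unfolding residual_def[abs_def] using residual_term_measurable by (rule borel_measurable_sum)

text \<open>The regularity condition speaks of deterministic points. Freezing v_i(k) at its value,
  which the history determines, makes it applicable; the 2 in the bound is the 1/2 carried by
  \<open>residual\<close>.\<close>

lemma cond_residual_ge:
  "AE \<omega> in M. ennreal (infeas k \<omega> / (2 * c)) \<le> nn_cond_exp M (F k) (\<lambda>\<omega>. ennreal (residual k \<omega>)) \<omega>"
proof -
  interpret finite_measure_subalgebra M "F k" using prob_space_subalgebra[OF subalgebra_F] .
  let ?r = "\<lambda>i \<omega>. ennreal ((infdist (v i k \<omega>) (Xs i (\<Omega> i k \<omega>)))\<^sup>2 / 2)"
  have one: "AE \<omega> in M. ennreal ((infdist (v i k \<omega>) X)\<^sup>2 / (2 * c)) \<le> nn_cond_exp M (F k) (?r i) \<omega>"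
    if i: "i \<in> V" for i
  proof -
    have "AE \<omega> in M. (\<Sum>j\<in>Idx i. ennreal ((infdist (v i k \<omega>) (Xs i j))\<^sup>2 / 2)
        * ennreal (prob {\<omega>\<in>space M. \<Omega> i k \<omega> = j})) = nn_cond_exp M (F k) (?r i) \<omega>"
      using indep_history[OF i] by (intro nn_cond_exp_independent_index subalgebra_F Idx[OF i] \<Omega>(1)[OF i]) auto
    then show ?thesis
    proof eventually_elim
      case (elim \<omega>)
      let ?p = "\<lambda>j. prob {\<omega>\<in>space M. \<Omega> i k \<omega> = j}"
      \<comment> \<open>The outcome \<open>\<omega>\<close> is fixed here, so
        \<open>v i k \<omega>\<close> is a constant point and the expectation runs over the index
        alone.\<close>
      have "(infdist (v i k \<omega>) X)\<^sup>2 \<le> c * (\<Sum>j\<in>Idx i. (infdist (v i k \<omega>) (Xs i j))\<^sup>2 * ?p j)"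
        using c(2)[OF i, of "v i k \<omega>" k]
          expectation_finite_index[OF Idx[OF i] \<Omega>(1)[OF i, of k], of "\<lambda>j. (infdist (v i k \<omega>) (Xs i j))\<^sup>2"]
        by simp
      then have "(infdist (v i k \<omega>) X)\<^sup>2 / (2 * c) \<le> (\<Sum>j\<in>Idx i. (infdist (v i k \<omega>) (Xs i j))\<^sup>2 * ?p j) / 2"
        using c(1) by (simp add: field_simps)
      also have "\<dots> = (\<Sum>j\<in>Idx i. (infdist (v i k \<omega>) (Xs i j))\<^sup>2 / 2 * ?p j)"
        by (simp add: sum_divide_distrib)
      finally have "ennreal ((infdist (v i k \<omega>) X)\<^sup>2 / (2 * c))
          \<le> ennreal (\<Sum>j\<in>Idx i. (infdist (v i k \<omega>) (Xs i j))\<^sup>2 / 2 * ?p j)" by (rule ennreal_leI)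
      also have "\<dots> = (\<Sum>j\<in>Idx i. ennreal ((infdist (v i k \<omega>) (Xs i j))\<^sup>2 / 2 * ?p j))"
        by (intro sum_ennreal[symmetric]) simp
      also have "\<dots> = (\<Sum>j\<in>Idx i. ennreal ((infdist (v i k \<omega>) (Xs i j))\<^sup>2 / 2) * ennreal (?p j))"
        by (intro sum.cong refl ennreal_mult) auto
      finally show ?case using elim by simp
    qed
  qed
  have "AE \<omega> in M. \<forall>i\<in>V. ennreal ((infdist (v i k \<omega>) X)\<^sup>2 / (2 * c)) \<le> nn_cond_exp M (F k) (?r i) \<omega>"
    using one V(1) by (simp add: AE_finite_all)
  moreover have "AE \<omega> in M. nn_cond_exp M (F k) (\<lambda>\<omega>. \<Sum>i\<in>V. ?r i \<omega>) \<omega> = (\<Sum>i\<in>V. nn_cond_exp M (F k) (?r i) \<omega>)"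
    using residual_term_measurable by (intro nn_cond_exp_finite_sum V) auto
  ultimately have "AE \<omega> in M. (\<Sum>i\<in>V. ennreal ((infdist (v i k \<omega>) X)\<^sup>2 / (2 * c)))
      \<le> nn_cond_exp M (F k) (\<lambda>\<omega>. \<Sum>i\<in>V. ?r i \<omega>) \<omega>"
  proof eventually_elim
    case (elim \<omega>)
    show ?case unfolding elim(2) using elim(1) by (intro sum_mono) auto
  qed
  moreover have "(\<lambda>\<omega>. \<Sum>i\<in>V. ?r i \<omega>) = (\<lambda>\<omega>. ennreal (residual k \<omega>))"
    by (simp add: residual_def)
  moreover have "(\<Sum>i\<in>V. ennreal ((infdist (v i k \<omega>) X)\<^sup>2 / (2 * c))) = ennreal (infeas k \<omega> / (2 * c))" for \<omega>
    using c(1) by (simp add: infeas_def sum_divide_distrib)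
  ultimately show ?thesis by simp
qed

lemma norms_measurable:
  "(\<lambda>\<omega>. \<Sum>i\<in>V. (infdist (x i k \<omega>) X)\<^sup>2) \<in> borel_measurable (F k)"
  "(\<lambda>\<omega>. \<Sum>i\<in>V. (norm (x i k \<omega> - xstar))\<^sup>2) \<in> borel_measurable (F k)"
  using x_measurable by measurable

text \<open>The pathwise estimate allows +1/(4c) of the infeasibility and the conditional residual
  returns 1/(2c), leaving -1/(4c).\<close>

lemma cond_infdist_le:
  "AE \<omega> in M. nonneg_cond_exp M (F k) (\<lambda>\<omega>. \<Sum>i\<in>V. (infdist (x i (Suc k) \<omega>) X)\<^sup>2) \<omega>
    \<le> ereal ((\<Sum>i\<in>V. (infdist (x i k \<omega>) X)\<^sup>2) - infeas k \<omega> / (4 * c) + C\<alpha> * (\<alpha> k)\<^sup>2)"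
proof -
  interpret finite_measure_subalgebra M "F k" using prob_space_subalgebra[OF subalgebra_F] .
  define A where "A \<omega> = (\<Sum>i\<in>V. (infdist (x i k \<omega>) X)\<^sup>2) + infeas k \<omega> / (4 * c) + C\<alpha> * (\<alpha> k)\<^sup>2" for \<omega>
  have "AE \<omega> in M. nonneg_cond_exp M (F k) (\<lambda>\<omega>. \<Sum>i\<in>V. (infdist (x i (Suc k) \<omega>) X)\<^sup>2) \<omega>
    \<le> ereal (A \<omega> - infeas k \<omega> / (2 * c))"
  proof (rule nonneg_cond_exp_le)
    show "(\<lambda>\<omega>. \<Sum>i\<in>V. (infdist (x i (Suc k) \<omega>) X)\<^sup>2) \<in> borel_measurable M"
      by (rule F_measurable_imp[OF norms_measurable(1)])
    show "A \<in> borel_measurable (F k)" unfolding A_def[abs_def] using norms_measurable(1) by measurable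
    show "AE \<omega> in M. (\<Sum>i\<in>V. (infdist (x i (Suc k) \<omega>) X)\<^sup>2) + residual k \<omega> \<le> A \<omega>"
      using B(3)
    proof (rule AE_mp, intro AE_I2 impI)
      fix \<omega> assume "\<omega> \<in> space M" "\<forall>i\<in>V. \<forall>k. norm (g i k \<omega>) \<le> B"
      then show "(\<Sum>i\<in>V. (infdist (x i (Suc k) \<omega>) X)\<^sup>2) + residual k \<omega> \<le> A \<omega>"
        unfolding A_def by (intro sum_infdist_step_le) auto
    qed
    show "0 \<le> infeas k \<omega> / (2 * c)" for \<omega> using nonneg c(1) by simp
  qed (auto intro: sum_nonneg nonneg cond_residual_ge residual_measurable)
  moreover have "A \<omega> - infeas k \<omega> / (2 * c)
      = (\<Sum>i\<in>V. (infdist (x i k \<omega>) X)\<^sup>2) - infeas k \<omega> / (4 * c) + C\<alpha> * (\<alpha> k)\<^sup>2" for \<omega>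
    using c(1) by (simp add: A_def field_simps)
  ultimately show ?thesis by simp
qed

text \<open>The infeasibility balance is the same as for the distances to \<open>X\<close>; gap and
  disagreement at time \<open>k\<close> are known from the history and stay in the bound
  \<open>A\<close>.\<close>

lemma cond_objective_le:
  "AE \<omega> in M. nonneg_cond_exp M (F k) (\<lambda>\<omega>. \<Sum>i\<in>V. (norm (x i (Suc k) \<omega> - xstar))\<^sup>2) \<omega>
    \<le> ereal ((\<Sum>i\<in>V. (norm (x i k \<omega> - xstar))\<^sup>2) - (infeas k \<omega> / (4 * c) + 2 * (\<alpha> k * gap k \<omega>))
      + (C\<alpha> * (\<alpha> k)\<^sup>2 + (4 * B + 1) * (\<alpha> k * disagr k \<omega>)))"
proof -
  interpret finite_measure_subalgebra M "F k" using prob_space_subalgebra[OF subalgebra_F] .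
  define A where "A \<omega> = (\<Sum>i\<in>V. (norm (x i k \<omega> - xstar))\<^sup>2) + infeas k \<omega> / (4 * c) + C\<alpha> * (\<alpha> k)\<^sup>2
    + (4 * B + 1) * (\<alpha> k * disagr k \<omega>) - 2 * (\<alpha> k * gap k \<omega>)" for \<omega>
  have "AE \<omega> in M. nonneg_cond_exp M (F k) (\<lambda>\<omega>. \<Sum>i\<in>V. (norm (x i (Suc k) \<omega> - xstar))\<^sup>2) \<omega>
    \<le> ereal (A \<omega> - infeas k \<omega> / (2 * c))"
  proof (rule nonneg_cond_exp_le)
    show "(\<lambda>\<omega>. \<Sum>i\<in>V. (norm (x i (Suc k) \<omega> - xstar))\<^sup>2) \<in> borel_measurable M"
      by (rule F_measurable_imp[OF norms_measurable(2)])
    show "A \<in> borel_measurable (F k)" unfolding A_def[abs_def] using norms_measurable(2) by measurable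
    show "AE \<omega> in M. (\<Sum>i\<in>V. (norm (x i (Suc k) \<omega> - xstar))\<^sup>2) + residual k \<omega> \<le> A \<omega>"
      using B(3)
    proof (rule AE_mp, intro AE_I2 impI)
      fix \<omega> assume "\<omega> \<in> space M" "\<forall>i\<in>V. \<forall>k. norm (g i k \<omega>) \<le> B"
      then show "(\<Sum>i\<in>V. (norm (x i (Suc k) \<omega> - xstar))\<^sup>2) + residual k \<omega> \<le> A \<omega>"
        unfolding A_def by (intro sum_objective_step_le) auto
    qed
    show "0 \<le> infeas k \<omega> / (2 * c)" for \<omega> using nonneg c(1) by simp
  qed (auto intro: sum_nonneg nonneg cond_residual_ge residual_measurable)
  moreover have "A \<omega> - infeas k \<omega> / (2 * c)
      = (\<Sum>i\<in>V. (norm (x i k \<omega> - xstar))\<^sup>2) - (infeas k \<omega> / (4 * c) + 2 * (\<alpha> k * gap k \<omega>))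
        + (C\<alpha> * (\<alpha> k)\<^sup>2 + (4 * B + 1) * (\<alpha> k * disagr k \<omega>))" for \<omega>
    using c(1) by (simp add: A_def field_simps)
  ultimately show ?thesis by simp
qed

text \<open>Weighting expectations by \<open>h\<close> makes the energy at time \<open>0\<close> integrable; \<open>h\<close> is
  measurable with respect to every \<open>F k\<close>, so it passes through the conditional expectations.\<close>

definition "h \<omega> = 1 / (1 + S0 \<omega>)"

lemma h: "0 < h \<omega>" "h \<omega> \<le> 1" "h \<omega> * S0 \<omega> \<le> 1"
  using S0_nonneg[of \<omega>] by (auto simp: h_def)

lemma h_measurable: "h \<in> borel_measurable (F k)"
  unfolding h_def[abs_def] using S0_measurable by measurable

lemma h_measurable_M[measurable]: "h \<in> borel_measurable M"
  by (rule F_measurable_imp[OF h_measurable])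

lemma measurable_M[measurable]:
  "infeas k \<in> borel_measurable M" "disagr k \<in> borel_measurable M" "gap k \<in> borel_measurable M"
  "S0 \<in> borel_measurable M"
  by (rule F_measurable_imp[OF terms_measurable(1)] F_measurable_imp[OF terms_measurable(2)]
      F_measurable_imp[OF terms_measurable(3)] F_measurable_imp[OF S0_measurable])+

section \<open>Finiteness of the weighted sums\<close>

lemma weighted_const_le: "(\<integral>\<^sup>+\<omega>. ennreal (h \<omega>) * ennreal t \<partial>M) \<le> ennreal t"
proof -
  have "(\<integral>\<^sup>+\<omega>. ennreal (h \<omega>) * ennreal t \<partial>M) \<le> (\<integral>\<^sup>+\<omega>. ennreal t \<partial>M)"
    using h(2) mult_right_mono[of "ennreal (h _)" 1 "ennreal t"] by (intro nn_integral_mono) simp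
  then show ?thesis by (simp add: emeasure_space_1)
qed

text \<open>\<open>h * S0\<close> never exceeds 1, so any initial energy below \<open>S0\<close> has
  weighted integral at most 1 whatever the law of the initial points.\<close>

lemma weighted_initial_le:
  assumes "\<And>\<omega>. u \<omega> \<le> S0 \<omega>" shows "(\<integral>\<^sup>+\<omega>. ennreal (h \<omega>) * ennreal (u \<omega>) \<partial>M) \<le> 1"
proof -
  have "(\<integral>\<^sup>+\<omega>. ennreal (h \<omega>) * ennreal (u \<omega>) \<partial>M) \<le> (\<integral>\<^sup>+\<omega>. 1 \<partial>M)"
  proof (rule nn_integral_mono)
    fix \<omega>
    have "ennreal (h \<omega>) * ennreal (u \<omega>) \<le> ennreal (h \<omega>) * ennreal (S0 \<omega>)"
      using assms by (intro mult_left_mono ennreal_leI) auto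
    also have "\<dots> = ennreal (h \<omega> * S0 \<omega>)" using h(1)[of \<omega>] S0_nonneg by (simp add: ennreal_mult less_imp_le)
    also have "\<dots> \<le> 1" using h(3) by simp
    finally show "ennreal (h \<omega>) * ennreal (u \<omega>) \<le> 1" .
  qed
  then show ?thesis by (simp add: emeasure_space_1)
qed

lemma weighted_steps_finite:
  assumes "0 \<le> C" shows "(\<Sum>k. \<integral>\<^sup>+\<omega>. ennreal (h \<omega>) * ennreal (C * (\<alpha> k)\<^sup>2) \<partial>M) < \<infinity>"
proof -
  have "(\<Sum>k. \<integral>\<^sup>+\<omega>. ennreal (h \<omega>) * ennreal (C * (\<alpha> k)\<^sup>2) \<partial>M) \<le> (\<Sum>k. ennreal (C * (\<alpha> k)\<^sup>2))"
    by (intro suminf_le weighted_const_le) auto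
  also have "\<dots> = ennreal (\<Sum>k. C * (\<alpha> k)\<^sup>2)"
    using assms \<alpha>(2) by (intro suminf_ennreal2) (auto intro: summable_mult)
  finally show ?thesis by (rule le_less_trans) simp
qed

text \<open>Only the squared step sizes perturb the first inequality. Its initial energy lies below
  \<open>S0\<close> because \<open>xstar\<close> belongs to \<open>X\<close>.\<close>

lemma weighted_infeas_finite:
  "(\<Sum>k. \<integral>\<^sup>+\<omega>. ennreal (h \<omega>) * ennreal (infeas k \<omega> / (4 * c)) \<partial>M) < \<infinity>"
proof -
  let ?U = "\<lambda>k \<omega>. \<Sum>i\<in>V. (infdist (x i k \<omega>) X)\<^sup>2"
  have "(\<Sum>k. \<integral>\<^sup>+\<omega>. ennreal (h \<omega>) * ennreal (infeas k \<omega> / (4 * c)) \<partial>M)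
      \<le> (\<integral>\<^sup>+\<omega>. ennreal (h \<omega>) * ennreal (?U 0 \<omega>) \<partial>M)
        + (\<Sum>k. \<integral>\<^sup>+\<omega>. ennreal (h \<omega>) * ennreal (C\<alpha> * (\<alpha> k)\<^sup>2) \<partial>M)"
    using c(1) nonneg C\<alpha>_pos
    by (intro weighted_supermartingale_sum_le[where F = F, OF subalgebra_F h_measurable] cond_infdist_le
        F_measurable_imp[OF norms_measurable(1)]) (auto intro!: sum_nonneg)
  also have "\<dots> \<le> 1 + (\<Sum>k. \<integral>\<^sup>+\<omega>. ennreal (h \<omega>) * ennreal (C\<alpha> * (\<alpha> k)\<^sup>2) \<partial>M)"
  proof (intro add_right_mono weighted_initial_le)
    show "?U 0 \<omega> \<le> S0 \<omega>" for \<omega>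
      unfolding S0_def using infdist_le[OF xstar(1)]
      by (intro sum_mono power_mono infdist_nonneg) (simp add: dist_norm)
  qed
  also have "\<dots> < \<infinity>"
    using weighted_steps_finite[of C\<alpha>] C\<alpha>_pos by simp
  finally show ?thesis .
qed

text \<open>The pathwise bound is integrated for each \<open>n\<close>; replacing the partial sums
  on the right by their full series makes the bound uniform in \<open>n\<close>.\<close>

lemma weighted_disagr_finite:
  "(\<Sum>k. \<integral>\<^sup>+\<omega>. ennreal (h \<omega>) * ennreal (\<alpha> k * disagr k \<omega>) \<partial>M) < \<infinity>"
proof -
  obtain K where K: "0 \<le> K" and le: "\<And>\<omega> n. \<omega> \<in> space M \<Longrightarrow> (\<forall>i\<in>V. \<forall>k. norm (g i k \<omega>) \<le> B)
      \<Longrightarrow> (\<Sum>k<n. \<alpha> k * disagr k \<omega>) \<le> K * (S0 \<omega> + (\<Sum>k<n. (\<alpha> k)\<^sup>2) + (\<Sum>k<n. infeas k \<omega>))"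
    using sum_disagr_le by blast
  define A where "A = (\<Sum>k. (\<alpha> k)\<^sup>2)"
  define T where "T = (\<Sum>k. \<integral>\<^sup>+\<omega>. ennreal (h \<omega>) * ennreal (infeas k \<omega> / (4 * c)) \<partial>M)"
  have \<gamma>0: "0 \<le> \<alpha> k * disagr k \<omega>" for k \<omega> using \<alpha>(1)[of k] nonneg(2) by simp
  have A: "(\<Sum>k<n. (\<alpha> k)\<^sup>2) \<le> A" "0 \<le> A" for n
    unfolding A_def using \<alpha>(2) by (auto intro: sum_le_suminf suminf_nonneg)
  have "(\<Sum>k<n. \<integral>\<^sup>+\<omega>. ennreal (h \<omega>) * ennreal (\<alpha> k * disagr k \<omega>) \<partial>M)
      \<le> ennreal K * (1 + ennreal A + ennreal (4 * c) * T)" for n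
  proof -
    have "(\<Sum>k<n. \<integral>\<^sup>+\<omega>. ennreal (h \<omega>) * ennreal (\<alpha> k * disagr k \<omega>) \<partial>M)
        = (\<integral>\<^sup>+\<omega>. ennreal (h \<omega>) * ennreal (\<Sum>k<n. \<alpha> k * disagr k \<omega>) \<partial>M)"
      using \<gamma>0 by (simp add: nn_integral_sum sum_distrib_left flip: sum_ennreal)
    also have "\<dots> \<le> (\<integral>\<^sup>+\<omega>. ennreal K * (ennreal (h \<omega>) * ennreal (S0 \<omega>) + ennreal (h \<omega>) * ennreal A
        + ennreal (4 * c) * (\<Sum>k<n. ennreal (h \<omega>) * ennreal (infeas k \<omega> / (4 * c)))) \<partial>M)"
    proof (rule nn_integral_mono_AE, rule AE_mp[OF B(3)], intro AE_I2 impI)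
      fix \<omega> assume "\<omega> \<in> space M" "\<forall>i\<in>V. \<forall>k. norm (g i k \<omega>) \<le> B"
      then have "(\<Sum>k<n. \<alpha> k * disagr k \<omega>) \<le> K * (S0 \<omega> + (\<Sum>k<n. (\<alpha> k)\<^sup>2) + (\<Sum>k<n. infeas k \<omega>))" by (rule le)
      also have "\<dots> \<le> K * (S0 \<omega> + A + (\<Sum>k<n. infeas k \<omega>))" using K A(1)[of n] by (intro mult_left_mono) auto
      \<comment> \<open>Rescaling by \<open>4 * c\<close> brings the infeasibility into the form
        whose weighted series \<open>T\<close> is already known to be finite.\<close>
      also have "(\<Sum>k<n. infeas k \<omega>) = 4 * c * (\<Sum>k<n. infeas k \<omega> / (4 * c))"
        using c(1) by (simp flip: sum_divide_distrib)
      finally have "ennreal (\<Sum>k<n. \<alpha> k * disagr k \<omega>)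
          \<le> ennreal (K * (S0 \<omega> + A + 4 * c * (\<Sum>k<n. infeas k \<omega> / (4 * c))))" by (rule ennreal_leI)
      also have "\<dots> = ennreal K * (ennreal (S0 \<omega>) + ennreal A
          + ennreal (4 * c) * (\<Sum>k<n. ennreal (infeas k \<omega> / (4 * c))))"
      proof -
        have "0 \<le> infeas k \<omega> / (4 * c)" for k using c(1) nonneg(1) by simp
        then have "(\<Sum>k<n. ennreal (infeas k \<omega> / (4 * c))) = ennreal (\<Sum>k<n. infeas k \<omega> / (4 * c))"
          "0 \<le> (\<Sum>k<n. infeas k \<omega> / (4 * c))"
          by (auto intro!: sum_ennreal sum_nonneg)
        then show ?thesis using K A(2) S0_nonneg[of \<omega>] c(1) by (simp add: ennreal_mult ennreal_plus)
      qed
      finally have "ennreal (h \<omega>) * ennreal (\<Sum>k<n. \<alpha> k * disagr k \<omega>)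
          \<le> ennreal (h \<omega>) * (ennreal K * (ennreal (S0 \<omega>) + ennreal A
            + ennreal (4 * c) * (\<Sum>k<n. ennreal (infeas k \<omega> / (4 * c)))))" by (rule mult_left_mono) simp
      also have "\<dots> = ennreal K * (ennreal (h \<omega>) * ennreal (S0 \<omega>) + ennreal (h \<omega>) * ennreal A
          + ennreal (4 * c) * (\<Sum>k<n. ennreal (h \<omega>) * ennreal (infeas k \<omega> / (4 * c))))"
        unfolding sum_distrib_left[symmetric] by (simp only: distrib_left mult_ac)
      finally show "ennreal (h \<omega>) * ennreal (\<Sum>k<n. \<alpha> k * disagr k \<omega>)
          \<le> ennreal K * (ennreal (h \<omega>) * ennreal (S0 \<omega>) + ennreal (h \<omega>) * ennreal A
            + ennreal (4 * c) * (\<Sum>k<n. ennreal (h \<omega>) * ennreal (infeas k \<omega> / (4 * c))))" .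
    qed
    also have "\<dots> = ennreal K * ((\<integral>\<^sup>+\<omega>. ennreal (h \<omega>) * ennreal (S0 \<omega>) \<partial>M)
        + (\<integral>\<^sup>+\<omega>. ennreal (h \<omega>) * ennreal A \<partial>M)
        + ennreal (4 * c) * (\<Sum>k<n. \<integral>\<^sup>+\<omega>. ennreal (h \<omega>) * ennreal (infeas k \<omega> / (4 * c)) \<partial>M))"
      by (subst nn_integral_cmult, simp, subst nn_integral_add, simp, simp, subst nn_integral_add, simp, simp,
          subst nn_integral_cmult, simp, subst nn_integral_sum, simp) (rule refl)
    also have "\<dots> \<le> ennreal K * (1 + ennreal A + ennreal (4 * c) * T)"
      unfolding T_def
      by (intro mult_left_mono add_mono weighted_initial_le weighted_const_le sum_le_suminf) auto
    finally show ?thesis .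
  qed
  then have "(\<Sum>k. \<integral>\<^sup>+\<omega>. ennreal (h \<omega>) * ennreal (\<alpha> k * disagr k \<omega>) \<partial>M)
      \<le> ennreal K * (1 + ennreal A + ennreal (4 * c) * T)"
    unfolding suminf_eq_SUP by (intro SUP_least)
  also have "\<dots> < \<infinity>"
    using weighted_infeas_finite by (simp add: T_def ennreal_mult_less_top)
  finally show ?thesis .
qed

text \<open>With the disagreement known to have a finite weighted sum, it can be counted among the
  perturbations of the second inequality, next to the squared step sizes.\<close>

lemma weighted_gap_finite:
  "(\<Sum>k. \<integral>\<^sup>+\<omega>. ennreal (h \<omega>) * ennreal (2 * (\<alpha> k * gap k \<omega>)) \<partial>M) < \<infinity>"
proof -
  let ?U = "\<lambda>k \<omega>. \<Sum>i\<in>V. (norm (x i k \<omega> - xstar))\<^sup>2"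
  let ?b = "\<lambda>k \<omega>. C\<alpha> * (\<alpha> k)\<^sup>2 + (4 * B + 1) * (\<alpha> k * disagr k \<omega>)"
  have \<gamma>0: "0 \<le> \<alpha> k * disagr k \<omega>" "0 \<le> \<alpha> k * gap k \<omega>" for k \<omega> using \<alpha>(1)[of k] nonneg(2,3) by simp_all
  have b0: "0 \<le> (4 * B + 1) * (\<alpha> k * disagr k \<omega>)" "0 \<le> C\<alpha> * (\<alpha> k)\<^sup>2" for k \<omega>
    using B(1) \<gamma>0(1)[of k \<omega>] C\<alpha>_pos by (simp_all del: zero_le_mult_iff)
  have "(\<Sum>k. \<integral>\<^sup>+\<omega>. ennreal (h \<omega>) * ennreal (2 * (\<alpha> k * gap k \<omega>)) \<partial>M)
      \<le> (\<integral>\<^sup>+\<omega>. ennreal (h \<omega>) * ennreal (?U 0 \<omega>) \<partial>M)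
        + (\<Sum>k. \<integral>\<^sup>+\<omega>. ennreal (h \<omega>) * ennreal (?b k \<omega>) \<partial>M)"
  proof (rule weighted_supermartingale_sum_le[where F = F, OF subalgebra_F h_measurable])
    show "AE \<omega> in M. nonneg_cond_exp M (F k) (?U (Suc k)) \<omega> \<le> ereal (?U k \<omega> - 2 * (\<alpha> k * gap k \<omega>) + ?b k \<omega>)" for k
      using cond_objective_le[of k]
    proof (rule AE_mp, intro AE_I2 impI)
      fix \<omega> assume "nonneg_cond_exp M (F k) (?U (Suc k)) \<omega>
        \<le> ereal (?U k \<omega> - (infeas k \<omega> / (4 * c) + 2 * (\<alpha> k * gap k \<omega>)) + ?b k \<omega>)"
      \<comment> \<open>The nonnegative infeasibility term is given up, so that the gap is the only
        decrease.\<close>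
      also have "\<dots> \<le> ereal (?U k \<omega> - 2 * (\<alpha> k * gap k \<omega>) + ?b k \<omega>)"
        using nonneg(1)[of k \<omega>] c(1) by simp
      finally show "nonneg_cond_exp M (F k) (?U (Suc k)) \<omega> \<le> ereal (?U k \<omega> - 2 * (\<alpha> k * gap k \<omega>) + ?b k \<omega>)" .
    qed
    show "?U k \<in> borel_measurable M" for k by (rule F_measurable_imp[OF norms_measurable(2)])
    show "0 \<le> ?b k \<omega>" for k \<omega> using b0 by (intro add_nonneg_nonneg)
    show "0 \<le> 2 * (\<alpha> k * gap k \<omega>)" for k \<omega> using \<gamma>0(2)[of k \<omega>] by linarith
  qed (auto intro: sum_nonneg)
  also have "(\<integral>\<^sup>+\<omega>. ennreal (h \<omega>) * ennreal (?U 0 \<omega>) \<partial>M) \<le> 1"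
    by (rule weighted_initial_le) (simp add: S0_def)
  also have "(\<Sum>k. \<integral>\<^sup>+\<omega>. ennreal (h \<omega>) * ennreal (?b k \<omega>) \<partial>M)
      = (\<Sum>k. (\<integral>\<^sup>+\<omega>. ennreal (h \<omega>) * ennreal (C\<alpha> * (\<alpha> k)\<^sup>2) \<partial>M)
        + ennreal (4 * B + 1) * (\<integral>\<^sup>+\<omega>. ennreal (h \<omega>) * ennreal (\<alpha> k * disagr k \<omega>) \<partial>M))"
  proof (rule suminf_cong)
    fix k
    have "ennreal (h \<omega>) * ennreal (?b k \<omega>) = ennreal (h \<omega>) * ennreal (C\<alpha> * (\<alpha> k)\<^sup>2)
        + ennreal (4 * B + 1) * (ennreal (h \<omega>) * ennreal (\<alpha> k * disagr k \<omega>))" for \<omega>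
    proof -
      have "ennreal (?b k \<omega>) = ennreal (C\<alpha> * (\<alpha> k)\<^sup>2) + ennreal (4 * B + 1) * ennreal (\<alpha> k * disagr k \<omega>)"
        using B(1) \<gamma>0(1)[of k \<omega>] ennreal_plus[OF b0(2)[of k] b0(1)[of k \<omega>]]
          ennreal_mult[of "4 * B + 1" "\<alpha> k * disagr k \<omega>"] by simp
      then show ?thesis by (simp only: distrib_left mult_ac)
    qed
    then show "(\<integral>\<^sup>+\<omega>. ennreal (h \<omega>) * ennreal (?b k \<omega>) \<partial>M) = (\<integral>\<^sup>+\<omega>. ennreal (h \<omega>) * ennreal (C\<alpha> * (\<alpha> k)\<^sup>2) \<partial>M)
        + ennreal (4 * B + 1) * (\<integral>\<^sup>+\<omega>. ennreal (h \<omega>) * ennreal (\<alpha> k * disagr k \<omega>) \<partial>M)"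
      by (simp add: nn_integral_add nn_integral_cmult)
  qed
  also have "\<dots> = (\<Sum>k. \<integral>\<^sup>+\<omega>. ennreal (h \<omega>) * ennreal (C\<alpha> * (\<alpha> k)\<^sup>2) \<partial>M)
      + ennreal (4 * B + 1) * (\<Sum>k. \<integral>\<^sup>+\<omega>. ennreal (h \<omega>) * ennreal (\<alpha> k * disagr k \<omega>) \<partial>M)"
    by (subst suminf_add[symmetric]) auto
  also have "1 + \<dots> < \<infinity>"
    using weighted_steps_finite[of C\<alpha>] weighted_disagr_finite C\<alpha>_pos by (simp add: ennreal_mult_less_top)
  finally show ?thesis by (simp add: add_right_mono)
qed

lemma AE_summable_terms:
  "AE \<omega> in M. summable (\<lambda>k. infeas k \<omega>)"
  "AE \<omega> in M. summable (\<lambda>k. \<alpha> k * disagr k \<omega>)"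
  "AE \<omega> in M. summable (\<lambda>k. \<alpha> k * gap k \<omega>)"
proof -
  have "AE \<omega> in M. summable (\<lambda>k. infeas k \<omega> / (4 * c))"
    using c(1) nonneg(1) by (intro AE_summable_of_weighted_sum[OF _ _ h(1) _ weighted_infeas_finite]) auto
  then show "AE \<omega> in M. summable (\<lambda>k. infeas k \<omega>)"
    using c(1) by (simp add: summable_divide_iff)
  show "AE \<omega> in M. summable (\<lambda>k. \<alpha> k * disagr k \<omega>)"
    using \<alpha>(1) nonneg(2)
    by (intro AE_summable_of_weighted_sum[OF _ _ h(1) _ weighted_disagr_finite]) (auto simp: less_imp_le)
  have "AE \<omega> in M. summable (\<lambda>k. 2 * (\<alpha> k * gap k \<omega>))"
    using \<alpha>(1) nonneg(3)
    by (intro AE_summable_of_weighted_sum[OF _ _ h(1) _ weighted_gap_finite]) (auto simp: less_imp_le)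
  then show "AE \<omega> in M. summable (\<lambda>k. \<alpha> k * gap k \<omega>)"
    by (simp add: summable_cmult_iff)
qed

end

section \<open>Transfer to the stated hypotheses and constants\<close>

theorem proposition4p1:
  fixes M :: "'w measure"
    and m n :: nat
    and Idx :: "nat \<Rightarrow> nat set"
    and f :: "nat \<Rightarrow> real ^ 'd \<Rightarrow> real"
    and Xs :: "nat \<Rightarrow> nat \<Rightarrow> (real ^ 'd) set"
    and E :: "nat \<Rightarrow> (nat \<times> nat) set"
    and w :: "nat \<Rightarrow> nat \<Rightarrow> nat \<Rightarrow> real"
    and \<alpha> :: "nat \<Rightarrow> real"
    and \<Omega> :: "nat \<Rightarrow> nat \<Rightarrow> 'w \<Rightarrow> nat"
    and x g v :: "nat \<Rightarrow> nat \<Rightarrow> 'w \<Rightarrow> real ^ 'd"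
    and \<gamma> :: "nat \<Rightarrow> nat \<Rightarrow> 'w \<Rightarrow> real"
    and F :: "nat \<Rightarrow> 'w measure"
    and V :: "nat set"
    and Xi :: "nat \<Rightarrow> (real ^ 'd) set"
    and X :: "(real ^ 'd) set"
    and N :: "nat \<Rightarrow> nat \<Rightarrow> nat set"
    and fsum :: "real ^ 'd \<Rightarrow> real"
    and xstar :: "real ^ 'd"
  defines "V \<equiv> {1..m}"
    and "Xi \<equiv> \<lambda>i. \<Inter>j\<in>Idx i. Xs i j"
    and "X \<equiv> \<Inter>i\<in>V. Xi i"
    and "fsum \<equiv> \<lambda>y. \<Sum>i\<in>V. f i y"
    and "N \<equiv> neighbours V E"
    and "F \<equiv> history M V Idx x \<Omega>"
    and "v \<equiv> weighted_state V E w x"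
    and "\<gamma> \<equiv> gamma_term V X fsum \<alpha> v"
  assumes prob: "prob_space M"
    and users: "m \<ge> 1"
    and indices: "(\<Union>i\<in>V. Idx i) = {1..n}" "disjoint_family_on Idx V"
      "\<forall>i\<in>V. Idx i \<noteq> {}"
    \<comment> \<open>(1) constraint sets and objective functions\<close>
    and sets: "\<forall>i\<in>V. \<forall>j\<in>Idx i. closed (Xs i j) \<and> convex (Xs i j)"
    and feasible: "X \<noteq> {}"
    and convex: "\<forall>i\<in>V. convex_on UNIV (f i)"
    and bound_M: "\<forall>i\<in>V. \<exists>Mi. \<forall>y\<in>Xi i. \<forall>s\<in>subdifferential (f i) y. norm s \<le> Mi"
    and bound_C: "\<forall>i\<in>V. \<exists>Ci. AE \<omega> in M. \<forall>k. \<forall>s\<in>subdifferential (f i) (v i k \<omega>). norm s \<le> Ci"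
    \<comment> \<open>(2) network\<close>
    and edges: "\<forall>k. E k \<subseteq> V \<times> V" "\<forall>k. \<forall>i\<in>V. (i, i) \<in> E k"
    and connected: "\<exists>Q\<ge>1. \<forall>k. strongly_connected
          (with_proj \<lparr>pverts = V, parcs = (\<Inter>l\<in>{0..Q - 1}. E (k + l))\<rparr>)"
    \<comment> \<open>(3) random indices\<close>
    and \<Omega>_measurable: "\<forall>i\<in>V. \<forall>k. \<Omega> i k \<in> measurable M (count_space (Idx i))"
    and x0_measurable: "\<forall>i\<in>V. x i 0 \<in> borel_measurable M"
    and \<Omega>_indep: "prob_space.indep_vars M (\<lambda>(i, k). count_space (Idx i)) (\<lambda>(i, k). \<Omega> i k)
          (V \<times> UNIV)"
    and \<Omega>_x0_indep: "prob_space.indep_set M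
          (generated_sigma M V (\<lambda>_. borel) (\<lambda>i. x i 0))
          (generated_sigma M (V \<times> UNIV) (\<lambda>(i, k). count_space (Idx i)) (\<lambda>(i, k). \<Omega> i k))"
    and \<Omega>_identical: "\<forall>i\<in>V. \<forall>k l. distr M (count_space (Idx i)) (\<Omega> i k)
          = distr M (count_space (Idx i)) (\<Omega> i l)"
    and \<Omega>_positive: "\<forall>i\<in>V. \<forall>j\<in>Idx i. \<forall>k. measure M {\<omega>\<in>space M. \<Omega> i k \<omega> = j} > 0"
    \<comment> \<open>(4) regularity of the constraint sets\<close>
    and regular: "\<exists>c>0. \<forall>i\<in>V. \<forall>y. \<forall>k. (infdist y X)\<^sup>2
          \<le> c * prob_space.expectation M (\<lambda>\<omega>. (infdist y (Xs i (\<Omega> i k \<omega>)))\<^sup>2)"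
    \<comment> \<open>(5) weights and step sizes\<close>
    and weights_nonneg: "\<forall>k. \<forall>i\<in>V. \<forall>j\<in>V. w i j k \<ge> 0"
    and weights_zero: "\<forall>k. \<forall>i\<in>V. \<forall>j\<in>V. j \<notin> N i k \<longrightarrow> w i j k = 0"
    and weights_row: "\<forall>k. \<forall>i\<in>V. (\<Sum>j\<in>V. w i j k) = 1"
    and weights_column: "\<forall>k. \<forall>j\<in>V. (\<Sum>i\<in>V. w i j k) = 1"
    and weights_lower: "\<exists>wmin. 0 < wmin \<and> wmin < 1 \<and>
          (\<forall>k. \<forall>i\<in>V. \<forall>j\<in>N i k. w i j k \<ge> wmin)"
    and steps: "\<forall>k. \<alpha> k > 0" "\<not> summable \<alpha>" "summable (\<lambda>k. (\<alpha> k)\<^sup>2)"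
    \<comment> \<open>the algorithm\<close>
    and g_measurable: "\<forall>i\<in>V. \<forall>k. g i k \<in> borel_measurable (F k)"
    and g_subgradient: "\<forall>i\<in>V. \<forall>k. \<forall>\<omega>\<in>space M. g i k \<omega> \<in> subdifferential (f i) (v i k \<omega>)"
    and x_step: "\<forall>i\<in>V. \<forall>k. \<forall>\<omega>\<in>space M.
          x i (k + 1) \<omega> = closest_point (Xs i (\<Omega> i k \<omega>)) (v i k \<omega> - \<alpha> k *\<^sub>R g i k \<omega>)"
    and xstar: "xstar \<in> solution_set fsum X"
  shows "(\<exists>\<beta> :: nat \<Rightarrow> real. (\<forall>j\<in>{1..4}. \<beta> j > 0) \<and>
            (AE \<omega> in M. \<forall>k.
               nonneg_cond_exp M (F k) (\<lambda>\<omega>'. \<Sum>i\<in>V. (infdist (x i (k + 1) \<omega>') X)\<^sup>2) \<omega>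
                 \<le> ereal ((\<Sum>i\<in>V. (infdist (x i k \<omega>) X)\<^sup>2) - \<beta> 1 * \<gamma> 1 k \<omega> + \<beta> 2 * \<gamma> 2 k \<omega>)
             \<and> nonneg_cond_exp M (F k) (\<lambda>\<omega>'. \<Sum>i\<in>V. (norm (x i (k + 1) \<omega>' - xstar))\<^sup>2) \<omega>
                 \<le> ereal ((\<Sum>i\<in>V. (norm (x i k \<omega> - xstar))\<^sup>2)
                     - (\<Sum>j\<in>{1,4}. \<beta> j * \<gamma> j k \<omega>) + (\<Sum>j\<in>{2,3}. \<beta> j * \<gamma> j k \<omega>))))
       \<and> (\<forall>j\<in>{1..4}. AE \<omega> in M. summable (\<lambda>k. \<gamma> j k \<omega>))"
proof -
  have V: "finite V" "V \<noteq> {}" using users by (auto simp: V_def)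
  obtain Mi where Mi: "\<And>i y s. i \<in> V \<Longrightarrow> y \<in> Xi i \<Longrightarrow> s \<in> subdifferential (f i) y \<Longrightarrow> norm s \<le> Mi i"
    using bchoice[OF bound_M] by auto
  obtain Ci where Ci: "\<And>i. i \<in> V \<Longrightarrow> AE \<omega> in M. \<forall>k. \<forall>s\<in>subdifferential (f i) (v i k \<omega>). norm s \<le> Ci i"
    using bchoice[OF bound_C] by auto
  obtain c where c: "c > 0" "\<And>i y k. i \<in> V \<Longrightarrow> (infdist y X)\<^sup>2
      \<le> c * prob_space.expectation M (\<lambda>\<omega>. (infdist y (Xs i (\<Omega> i k \<omega>)))\<^sup>2)"
    using regular by blast
  obtain wmin where wmin: "0 < wmin" "wmin < 1" "\<And>i j k. i \<in> V \<Longrightarrow> j \<in> N i k \<Longrightarrow> wmin \<le> w i j k"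
    using weights_lower by blast
  obtain Q :: nat where "Q \<ge> 1"
    and Q: "\<And>k. strongly_connected (with_proj \<lparr>pverts = V, parcs = (\<Inter>l\<in>{0..Q - 1}. E (k + l))\<rparr>)"
    using connected by blast
  \<comment> \<open>Absolute values make every summand nonnegative, so the sum dominates each
    individual bound even if some of them are negative.\<close>
  define B where "B = (\<Sum>i\<in>V. \<bar>Mi i\<bar> + \<bar>Ci i\<bar>)"
  have B: "0 \<le> B" unfolding B_def by (intro sum_nonneg) auto
  have BM: "\<bar>Mi i\<bar> + \<bar>Ci i\<bar> \<le> B" if "i \<in> V" for i
    unfolding B_def using that V(1) by (intro member_le_sum) auto
  have X_sub: "X \<subseteq> Xi i" if "i \<in> V" for i unfolding X_def using that by blast
  have Xi_sub: "Xi i \<subseteq> Xs i j" if "j \<in> Idx i" for i j unfolding Xi_def using that by blast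
  have opt: "xstar \<in> X" "opt_value fsum X = ereal (fsum xstar)"
    using xstar by (auto simp: solution_set_def)
  interpret prob_space M by (rule prob)
  interpret R: random_projected_subgradient M V Idx f Xs X E w \<alpha> \<Omega> x g xstar B c wmin
  proof (unfold_locales)
    show "finite (Idx i)" if "i \<in> V" for i
      using indices(1) that by (metis UN_upper finite_atLeastAtMost finite_subset)
    show "closed (Xs i j)" "convex (Xs i j)" if "i \<in> V" "j \<in> Idx i" for i j using sets that by auto
    show "closed X" "convex X"
      unfolding X_def Xi_def using sets by (auto intro!: closed_INT convex_INT)
    show "X \<subseteq> Xs i j" if "i \<in> V" "j \<in> Idx i" for i j using X_sub Xi_sub that by blast
    show "norm s \<le> B" if "i \<in> V" "y \<in> X" "s \<in> subdifferential (f i) y" for i y s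
      using Mi[of i y s] BM[of i] X_sub[of i] that by fastforce
    have "AE \<omega> in M. \<forall>i\<in>V. \<forall>k. \<forall>s\<in>subdifferential (f i) (v i k \<omega>). norm s \<le> Ci i"
      using Ci V(1) by (simp add: AE_finite_all)
    then show "AE \<omega> in M. \<forall>i\<in>V. \<forall>k. norm (g i k \<omega>) \<le> B"
    proof (rule AE_mp, intro AE_I2 impI ballI allI)
      fix \<omega> i k assume "\<omega> \<in> space M" "i \<in> V"
        and "\<forall>i\<in>V. \<forall>k. \<forall>s\<in>subdifferential (f i) (v i k \<omega>). norm s \<le> Ci i"
      then have "norm (g i k \<omega>) \<le> Ci i" using g_subgradient by blast
      then show "norm (g i k \<omega>) \<le> B" using BM[OF \<open>i \<in> V\<close>] by linarith
    qed
    \<comment> \<open>The window starting at \<open>k\<close> contains \<open>l = 0\<close>, so its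
      intersection is a subset of \<open>E k\<close>.\<close>
    show "V \<times> V \<subseteq> (E k)\<^sup>*" for k
      using strongly_connected_superset[OF Q[of k], of "E k"] by fastforce
    show "w i j k = 0" if "i \<in> V" "j \<in> V" "(i, j) \<notin> E k" for i j k
      using weights_zero that by (auto simp: N_def neighbours_def)
    show "wmin \<le> w i j k" if "(i, j) \<in> E k" for i j k
      using wmin(3)[of i j k] edges(1) that by (auto simp: N_def neighbours_def)
    show "(\<Sum>i\<in>V. f i xstar) \<le> (\<Sum>i\<in>V. f i y)" if "y \<in> X" for y
    proof -
      \<comment> \<open>The extended-real infimum equals the real value at \<open>xstar\<close>, so
        its lower-bound property becomes an inequality between reals.\<close>
      have "ereal (fsum xstar) \<le> ereal (fsum y)"
        unfolding opt(2)[symmetric] opt_value_def using that by (rule INF_lower)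
      then show ?thesis by (simp add: fsum_def)
    qed
  qed (use V B c wmin opt(1) convex edges \<Omega>_measurable \<Omega>_indep x0_measurable \<Omega>_x0_indep weights_nonneg
      weights_row weights_column steps g_measurable g_subgradient x_step
      in \<open>auto simp: F_def v_def\<close>)
  have \<gamma>: "\<gamma> 1 k \<omega> = R.infeas k \<omega>" "\<gamma> 2 k \<omega> = (\<alpha> k)\<^sup>2" "\<gamma> 3 k \<omega> = \<alpha> k * R.disagr k \<omega>"
    "\<gamma> 4 k \<omega> = \<alpha> k * R.gap k \<omega>" for k \<omega>
    unfolding \<gamma>_def gamma_term_def opt(2)
    by (simp_all add: R.infeas_def R.disagr_def R.gap_def fsum_def v_def)
  have four: "{1..4::nat} = {1, 2, 3, 4}" by auto
  \<comment> \<open>The coefficients of the conditional inequalities, in the numbering of the terms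
    \<open>\<gamma>\<close>.\<close>
  define \<beta> :: "nat \<Rightarrow> real" where
    "\<beta> j = (if j = 1 then 1 / (4 * c) else if j = 2 then R.C\<alpha> else if j = 3 then 4 * B + 1 else 2)" for j
  have "AE \<omega> in M. \<forall>k.
      nonneg_cond_exp M (F k) (\<lambda>\<omega>'. \<Sum>i\<in>V. (infdist (x i (k + 1) \<omega>') X)\<^sup>2) \<omega>
        \<le> ereal ((\<Sum>i\<in>V. (infdist (x i k \<omega>) X)\<^sup>2) - \<beta> 1 * \<gamma> 1 k \<omega> + \<beta> 2 * \<gamma> 2 k \<omega>)
    \<and> nonneg_cond_exp M (F k) (\<lambda>\<omega>'. \<Sum>i\<in>V. (norm (x i (k + 1) \<omega>' - xstar))\<^sup>2) \<omega>
        \<le> ereal ((\<Sum>i\<in>V. (norm (x i k \<omega> - xstar))\<^sup>2)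
            - (\<Sum>j\<in>{1,4}. \<beta> j * \<gamma> j k \<omega>) + (\<Sum>j\<in>{2,3}. \<beta> j * \<gamma> j k \<omega>))"
    \<comment> \<open>The exceptional sets for the individual times are countably many, so one null
      set serves all \<open>k\<close>.\<close>
    unfolding AE_all_countable
  proof (intro allI AE_conjI)
    fix k
    show "AE \<omega> in M. nonneg_cond_exp M (F k) (\<lambda>\<omega>'. \<Sum>i\<in>V. (infdist (x i (k + 1) \<omega>') X)\<^sup>2) \<omega>
        \<le> ereal ((\<Sum>i\<in>V. (infdist (x i k \<omega>) X)\<^sup>2) - \<beta> 1 * \<gamma> 1 k \<omega> + \<beta> 2 * \<gamma> 2 k \<omega>)"
      using R.cond_infdist_le[of k] by (simp add: \<gamma>[unfolded One_nat_def] \<beta>_def F_def)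
    show "AE \<omega> in M. nonneg_cond_exp M (F k) (\<lambda>\<omega>'. \<Sum>i\<in>V. (norm (x i (k + 1) \<omega>' - xstar))\<^sup>2) \<omega>
        \<le> ereal ((\<Sum>i\<in>V. (norm (x i k \<omega> - xstar))\<^sup>2)
            - (\<Sum>j\<in>{1,4}. \<beta> j * \<gamma> j k \<omega>) + (\<Sum>j\<in>{2,3}. \<beta> j * \<gamma> j k \<omega>))"
      using R.cond_objective_le[of k] by (simp add: \<gamma>[unfolded One_nat_def] \<beta>_def F_def)
  qed
  moreover have "\<forall>j\<in>{1..4}. \<beta> j > 0" using c(1) B R.C\<alpha>_pos by (auto simp: \<beta>_def)
  moreover have "\<forall>j\<in>{1..4}. AE \<omega> in M. summable (\<lambda>k. \<gamma> j k \<omega>)"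
    unfolding four using R.AE_summable_terms steps(3) by (simp add: \<gamma>[unfolded One_nat_def])
  ultimately show ?thesis by blast
qed

end
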